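(* Let $\Omega$ be either the unit polydisc $\mathbb{D}^d$ or the open Euclidean unit ball $\mathbb{B}_d$ in $\mathbb{C}^d$, let $G$ be a finite pseudoreflection group acting on $\Omega$ by $\sigma\cdot z=\sigma z$, and let $\boldsymbol\theta$ be a basic polynomial map associated to $G$. For every one-dimensional representation $\varrho$ of $G$, $H^2_\varrho(\boldsymbol\theta(\Omega))$ is isometrically embedded in $L^2_\varrho(\partial\boldsymbol\theta(\Omega))$.
   Context: A pseudoreflection on $\mathbb{C}^d$ is a linear map $\sigma\in GL(d,\mathbb{C})$ of finite order such that $I_d-\sigma$ has rank $1$; a pseudoreflection group is a group generated by pseudoreflections. By the Chevalley–Shephard–Todd theorem, $\mathbb{C}[z_1,\dots,z_d]^G=\mathbb{C}[\theta_1,\dots,\theta_d]$ for algebraically independent homogeneous polynomials $\theta_i$, where $G$ acts on functions by $\sigma(f)(z)=f(\sigma^{-1}\cdot z)$; $\boldsymbol\theta=(\theta_1,\dots,\theta_d)$ is called a basic polynomial map associated to $G$. $\boldsymbol\theta(\Omega)$ is a domain. $\partial X$ denotes the Shilov boundary of a domain $X$; $\partial\mathbb{D}^d=\mathbb{T}^d$ and $\partial\mathbb{B}_d=S_d$ (unit sphere), each with its normalized Lebesgue measure, denoted here $m$. Generating polynomial $\ell_\varrho$: let $H_1,\dots,H_t$ be the distinct reflecting hyperplanes of $G$ (hyperplanes fixed pointwise by some pseudoreflection in $G$), let $G_i=\langle a_i\rangle$ be the cyclic subgroup of elements of $G$ acting trivially on $H_i$, and let $\ell_i$ be a linear polynomial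 with zero set $H_i$. Let $c_i$ be the least non-negative integer with $\varrho(a_i)=(\det a_i)^{c_i}$, and put $\ell_\varrho=\prod_{i=1}^t\ell_i^{c_i}$. $L^2_\varrho(\partial\boldsymbol\theta(\Omega))$ is the $L^2$ space of the measure $m_\varrho$ on $\partial\boldsymbol\theta(\Omega)$ defined by $\int_{\partial\boldsymbol\theta(\Omega)}f\,dm_\varrho=\int_{\partial\Omega}(f\circ\boldsymbol\theta)|\ell_\varrho|^2\,dm$, with norm $\|f\|^2=\frac1{|G|}\int|f|^2dm_\varrho$. $H^2_\varrho(\boldsymbol\theta(\Omega))$ is the Hilbert space of holomorphic $f$ on $\boldsymbol\theta(\Omega)$ with $$\|f\|^2=\frac1{|G|}\sup_{0<r<1}\int_{\partial\Omega}|f(\boldsymbol\theta(r\zeta))|^2|\ell_\varrho(r\zeta)|^2\,dm(\zeta)<\infty.$$ *)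

theory Defs
  imports "HOL-Analysis.Analysis" "HOL-Algebra.Generated_Groups"
begin

section \<open>Pseudoreflection groups\<close>

definition GL :: "(complex^'n^'n) monoid" where
  "GL = \<lparr>carrier = {A. invertible A}, mult = (**), one = mat 1\<rparr>"

definition mult_group_complex :: "complex monoid" where
  "mult_group_complex = \<lparr>carrier = {z. z \<noteq> 0}, mult = (*), one = 1\<rparr>"

definition pseudoreflection :: "complex^'n^'n \<Rightarrow> bool" where
  "pseudoreflection \<sigma> \<longleftrightarrow>
     \<sigma> \<in> carrier GL \<and> (\<exists>k::nat. 0 < k \<and> \<sigma> [^]\<^bsub>GL\<^esub> k = \<one>\<^bsub>GL\<^esub>) \<and> rank (mat 1 - \<sigma>) = 1"

definition pseudoreflection_group :: "(complex^'n^'n) set \<Rightarrow> bool" where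
  "pseudoreflection_group G \<longleftrightarrow> (\<exists>S. (\<forall>\<sigma>\<in>S. pseudoreflection \<sigma>) \<and> G = generate GL S)"

definition one_dim_representation ::
  "(complex^'n^'n) set \<Rightarrow> (complex^'n^'n \<Rightarrow> complex) \<Rightarrow> bool" where
  "one_dim_representation G \<rho> \<longleftrightarrow> \<rho> \<in> hom (GL\<lparr>carrier := G\<rparr>) mult_group_complex"


section \<open>Polynomials in several variables\<close>

text \<open>
  Polynomials are represented by the functions they induce on \<open>\<complex>\<^sup>n\<close>, which is harmless
  since the coefficient field is infinite.
\<close>

definition polynomial_fun :: "(complex^'n \<Rightarrow> complex) \<Rightarrow> bool" where
  "polynomial_fun p \<longleftrightarrow>
     (\<exists>(A :: ('n \<Rightarrow> nat) set) c. finite A \<and>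
        p = (\<lambda>z. \<Sum>\<alpha>\<in>A. c \<alpha> * (\<Prod>i\<in>UNIV. (z $ i) ^ \<alpha> i)))"

definition homogeneous_fun :: "nat \<Rightarrow> (complex^'n \<Rightarrow> complex) \<Rightarrow> bool" where
  "homogeneous_fun k p \<longleftrightarrow>
     (\<exists>(A :: ('n \<Rightarrow> nat) set) c. finite A \<and> (\<forall>\<alpha>\<in>A. (\<Sum>i\<in>UNIV. \<alpha> i) = k) \<and>
        p = (\<lambda>z. \<Sum>\<alpha>\<in>A. c \<alpha> * (\<Prod>i\<in>UNIV. (z $ i) ^ \<alpha> i)))"

definition invariant_fun :: "(complex^'n^'n) set \<Rightarrow> (complex^'n \<Rightarrow> complex) \<Rightarrow> bool" where
  "invariant_fun G p \<longleftrightarrow> (\<forall>\<sigma>\<in>G. \<forall>z. p (matrix_inv \<sigma> *v z) = p z)"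

definition algebraically_independent :: "(complex^'n \<Rightarrow> complex^'n) \<Rightarrow> bool" where
  "algebraically_independent \<theta> \<longleftrightarrow>
     (\<forall>q. polynomial_fun q \<and> (\<forall>z. q (\<theta> z) = 0) \<longrightarrow> (\<forall>w. q w = 0))"

definition basic_polynomial_map ::
  "(complex^'n^'n) set \<Rightarrow> (complex^'n \<Rightarrow> complex^'n) \<Rightarrow> bool" where
  "basic_polynomial_map G \<theta> \<longleftrightarrow>
     (\<forall>i. \<exists>k. homogeneous_fun k (\<lambda>z. \<theta> z $ i)) \<and>
     algebraically_independent \<theta> \<and>
     {p. polynomial_fun p \<and> invariant_fun G p} = {q \<circ> \<theta> | q. polynomial_fun q}"


section \<open>The generating polynomial of a one-dimensional representation\<close>

definition reflecting_hyperplanes :: "(complex^'n^'n) set \<Rightarrow> (complex^'n) set set" where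
  "reflecting_hyperplanes G = {{z. \<sigma> *v z = z} | \<sigma>. \<sigma> \<in> G \<and> pseudoreflection \<sigma>}"

definition pointwise_stabilizer ::
  "(complex^'n^'n) set \<Rightarrow> (complex^'n) set \<Rightarrow> (complex^'n^'n) set" where
  "pointwise_stabilizer G H = {\<sigma> \<in> G. \<forall>z\<in>H. \<sigma> *v z = z}"

text \<open>
  The generators \<open>a H\<close> of the cyclic groups and the linear polynomials \<open>L H\<close> are arbitrary choices,
  so this is a predicate on \<open>\<ll>\<close> rather than a function. A linear polynomial vanishing on \<open>H\<close>
  vanishes at the origin, hence is homogeneous of degree 1.
\<close>

definition generating_polynomial ::
  "(complex^'n^'n) set \<Rightarrow> (complex^'n^'n \<Rightarrow> complex) \<Rightarrow> (complex^'n \<Rightarrow> complex) \<Rightarrow> bool" where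
  "generating_polynomial G \<rho> \<ll> \<longleftrightarrow>
     (\<exists>a L.
        (\<forall>H\<in>reflecting_hyperplanes G.
           a H \<in> G \<and> generate GL {a H} = pointwise_stabilizer G H \<and>
           homogeneous_fun 1 (L H) \<and> {z. L H z = 0} = H) \<and>
        \<ll> = (\<lambda>z. \<Prod>H\<in>reflecting_hyperplanes G.
                  L H z ^ (LEAST c. \<rho> (a H) = det (a H) ^ c)))"


section \<open>Polydisc, ball and the measures on their Shilov boundaries\<close>

definition polydisc :: "(complex^'n) set" where
  "polydisc = {z. \<forall>i. cmod (z $ i) < 1}"

definition torus :: "(complex^'n) set" where
  "torus = {z. \<forall>i. cmod (z $ i) = 1}"

definition torus_measure :: "(complex^'n) measure" where
  "torus_measure = restrict_space
     (distr (uniform_measure lborel (cbox 0 (\<chi> i. 2 * pi))) borel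
        (\<lambda>t::real^'n. \<chi> i. cis (t $ i))) torus"

text \<open>
  The normalized surface measure of a subset of the unit sphere is the normalized Lebesgue measure
  of the part of the unit ball on the rays through that subset.
\<close>

definition sphere_measure :: "(complex^'n) measure" where
  "sphere_measure = restrict_space
     (distr (uniform_measure lborel (ball 0 1)) borel (\<lambda>z. z /\<^sub>R norm z)) (sphere 0 1)"


section \<open>Holomorphic functions of several variables and the Shilov boundary\<close>

definition holomorphic_vec :: "(complex^'n \<Rightarrow> complex) \<Rightarrow> (complex^'n) set \<Rightarrow> bool" where
  "holomorphic_vec f X \<longleftrightarrow>
     (\<forall>z\<in>X. \<exists>D. (f has_derivative D) (at z) \<and> (\<forall>c v. D (c *s v) = c * D v))"

definition boundary_for :: "(complex^'n) set \<Rightarrow> (complex^'n) set \<Rightarrow> bool" where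
  "boundary_for X K \<longleftrightarrow>
     closed K \<and> K \<subseteq> closure X \<and>
     (\<forall>f. continuous_on (closure X) f \<and> holomorphic_vec f X \<longrightarrow>
        (\<forall>z\<in>closure X. \<exists>w\<in>K. cmod (f z) \<le> cmod (f w)))"

text \<open>For bounded \<open>X\<close>, the intersection is itself a boundary, hence the smallest one.\<close>

definition shilov_boundary :: "(complex^'n) set \<Rightarrow> (complex^'n) set" where
  "shilov_boundary X = \<Inter> {K. boundary_for X K}"


section \<open>The spaces \<open>L\<^sup>2\<close> and \<open>H\<^sup>2\<close>\<close>

text \<open>
  In the following, \<open>m\<close> is the measure on the Shilov boundary of \<open>\<Omega>\<close> and \<open>\<ll>\<close> is the
  generating polynomial of the representation.
\<close>

definition weighted_boundary_measure ::
  "(complex^'n) set \<Rightarrow> (complex^'n) measure \<Rightarrow> (complex^'n \<Rightarrow> complex^'n) \<Rightarrow>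
   (complex^'n \<Rightarrow> complex) \<Rightarrow> (complex^'n) measure" where
  "weighted_boundary_measure \<Omega> m \<theta> \<ll> =
     distr (density m (\<lambda>\<zeta>. ennreal ((cmod (\<ll> \<zeta>))\<^sup>2)))
       (restrict_space borel (shilov_boundary (\<theta> ` \<Omega>))) \<theta>"

text \<open>Representatives of the elements of \<open>L\<^sup>2(M)\<close>; they are to be compared almost everywhere.\<close>

definition L2_space :: "(complex^'n) measure \<Rightarrow> (complex^'n \<Rightarrow> complex) set" where
  "L2_space M = {g \<in> borel_measurable M. integrable M (\<lambda>w. (cmod (g w))\<^sup>2)}"

definition L2_norm ::
  "(complex^'n^'n) set \<Rightarrow> (complex^'n) measure \<Rightarrow> (complex^'n \<Rightarrow> complex) \<Rightarrow> real" where
  "L2_norm G M g = sqrt ((\<integral>w. (cmod (g w))\<^sup>2 \<partial>M) / card G)"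

definition hardy_sup ::
  "(complex^'n) measure \<Rightarrow> (complex^'n \<Rightarrow> complex^'n) \<Rightarrow> (complex^'n \<Rightarrow> complex) \<Rightarrow>
   (complex^'n \<Rightarrow> complex) \<Rightarrow> ennreal" where
  "hardy_sup m \<theta> \<ll> f =
     (SUP r\<in>{0<..<1::real}.
        \<integral>\<^sup>+\<zeta>. ennreal ((cmod (f (\<theta> (r *\<^sub>R \<zeta>))))\<^sup>2 * (cmod (\<ll> (r *\<^sub>R \<zeta>)))\<^sup>2) \<partial>m)"

text \<open>Only the values on \<open>\<theta> ` \<Omega>\<close> of an element of the space matter.\<close>

definition H2_space ::
  "(complex^'n) set \<Rightarrow> (complex^'n) measure \<Rightarrow> (complex^'n \<Rightarrow> complex^'n) \<Rightarrow>
   (complex^'n \<Rightarrow> complex) \<Rightarrow> (complex^'n \<Rightarrow> complex) set" where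
  "H2_space \<Omega> m \<theta> \<ll> = {f. holomorphic_vec f (\<theta> ` \<Omega>) \<and> hardy_sup m \<theta> \<ll> f < \<infinity>}"

definition H2_norm ::
  "(complex^'n^'n) set \<Rightarrow> (complex^'n) measure \<Rightarrow> (complex^'n \<Rightarrow> complex^'n) \<Rightarrow>
   (complex^'n \<Rightarrow> complex) \<Rightarrow> (complex^'n \<Rightarrow> complex) \<Rightarrow> real" where
  "H2_norm G m \<theta> \<ll> f = sqrt (enn2real (hardy_sup m \<theta> \<ll> f) / card G)"

text \<open>
  \<open>g\<close> is the boundary value of \<open>f\<close>: pulled back by \<open>\<theta>\<close> and multiplied by \<open>\<ll>\<close>, the dilates
  of \<open>f\<close> converge to \<open>g\<close> in \<open>L\<^sup>2(m)\<close>, as for boundary values in the Hardy space of \<open>\<Omega>\<close>.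
\<close>

definition boundary_value ::
  "(complex^'n) measure \<Rightarrow> (complex^'n \<Rightarrow> complex^'n) \<Rightarrow> (complex^'n \<Rightarrow> complex) \<Rightarrow>
   (complex^'n \<Rightarrow> complex) \<Rightarrow> (complex^'n \<Rightarrow> complex) \<Rightarrow> bool" where
  "boundary_value m \<theta> \<ll> f g \<longleftrightarrow>
     ((\<lambda>r::real. \<integral>\<^sup>+\<zeta>. ennreal ((cmod (f (\<theta> (r *\<^sub>R \<zeta>)) * \<ll> (r *\<^sub>R \<zeta>) - g (\<theta> \<zeta>) * \<ll> \<zeta>))\<^sup>2) \<partial>m)
        \<longlongrightarrow> 0) (at_left 1)"

end

theory Submission
  imports Defs "HOL-Complex_Analysis.Cauchy_Integral_Formula"
begin

text \<open>
  Put \<open>F = (f \<circ> \<theta>) \<ll>\<close> and \<open>F\<^sub>r \<zeta> = F (r \<zeta>)\<close>. The measure \<open>m\<close> is invariant under the circle action, so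
  averaging the one-variable slices \<open>w \<mapsto> F (w \<zeta>)\<close> over circles and using Parseval's identity shows that
  \<open>N r = \<parallel>F\<^sub>r\<parallel>\<^sup>2\<close> is increasing and that \<open>\<parallel>F\<^sub>r - F\<^sub>s\<parallel>\<^sup>2 = N r + N s - 2 N (sqrt (r s))\<close>. If \<open>N\<close> is
  bounded, then \<open>F\<^sub>r\<close> is therefore a Cauchy family in \<open>L\<^sup>2(m)\<close> as \<open>r \<rightarrow> 1\<close>, and its limit has squared norm \<open>sup N\<close>.

  Since \<open>\<ll>\<close> and the components of \<open>\<theta>\<close> are homogeneous, \<open>F\<^sub>r = (u\<^sub>r \<circ> \<theta>) \<ll>\<close>, where \<open>u\<^sub>r\<close> is, up to a power of
  \<open>r\<close>, the composition of \<open>f\<close> with a weighted dilation. So \<open>u\<^sub>r\<close> is a Cauchy family for the weighted measure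
  on the Shilov boundary of \<open>\<theta> ` \<Omega>\<close>, and the embedding sends \<open>f\<close> to its limit. That \<open>\<theta>\<close> maps the
  Shilov boundary of \<open>\<Omega>\<close> into that of \<open>\<theta> ` \<Omega>\<close> follows by symmetrizing powers of a peak polynomial.
\<close>

section \<open>Invariance of Lebesgue measure\<close>

text \<open>A limit of the \<open>F_r\<close> taken in \<open>L^2(m)\<close> would still have to be
  shown to have the form \<open>(g \<circ> \<theta>) \<ll>\<close>, with a division by
  \<open>\<ll>\<close>, which may vanish. This is avoided by using completeness on the image side:
  the \<open>u_r\<close> are functions of the image variable already, so their limit is one too. For
  this, \<open>u_r\<close> has to make sense on the whole Shilov boundary of the image, and it does:
  each of its points is \<open>\<theta> z\<close> with \<open>z\<close> in the closure of
  \<open>\<Omega>\<close>, and a factor \<open>r < 1\<close> moves \<open>z\<close> into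
  \<open>\<Omega>\<close>.

  The square root in the identity for two radii comes from orthogonality of the powers of
  \<open>w\<close> on circles: the mixed term of the radii \<open>r\<close> and \<open>s\<close>
  depends on the product \<open>r s\<close> only, so it is the mean square at the radius
  \<open>sqrt (r s)\<close>. Boundedness and monotonicity of \<open>N\<close> then suffice; no
  pointwise boundary limits enter.

  Ball and polydisc are treated alike because in both cases the points of the boundary set have the
  largest Euclidean norm \<open>R\<close> in the closure, \<open>R = 1\<close> or
  \<open>R = sqrt d\<close>. Hence a peak polynomial of a Euclidean ball serves for both.\<close>

lemma lborel_distr_orthogonal:
  fixes T :: "'a::euclidean_space \<Rightarrow> 'a"
  assumes T: "orthogonal_transformation T"
  shows "distr lborel borel T = lborel"
proof (rule measure_eqI)
  have lin: "linear T" using T by (simp add: orthogonal_transformation_linear)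
  interpret linear T by (fact lin)
  have [measurable]: "T \<in> borel_measurable borel"
    using lin by (intro borel_measurable_continuous_onI linear_continuous_on) (simp add: linear_linear)
  show "sets (distr lborel borel T) = sets lborel" by simp
  fix A assume "A \<in> sets (distr lborel borel T)"
  then have A[measurable]: "A \<in> sets borel" by simp
  define B where "B = ball (0::'a) 1"
  have B[measurable]: "B \<in> sets borel" by (simp add: B_def)
  have transl: "(\<integral>\<^sup>+x. h (x + c) \<partial>lborel) = (\<integral>\<^sup>+x. h x \<partial>lborel)"
    if [measurable]: "h \<in> borel_measurable borel" for h :: "'a \<Rightarrow> ennreal" and c
  proof -
    have "(\<integral>\<^sup>+x. h x \<partial>lborel) = (\<integral>\<^sup>+x. h x \<partial>distr lborel borel ((+) c))"
      by (simp add: lborel_distr_plus)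
    also have "\<dots> = (\<integral>\<^sup>+x. h (c + x) \<partial>lborel)" by (subst nn_integral_distr) auto
    finally show ?thesis by (simp add: add.commute)
  qed
  have TB: "- T x \<in> B \<longleftrightarrow> x \<in> B" for x
    using orthogonal_transformation_norm[OF T, of x] by (simp add: B_def)
  \<comment> \<open>Uniqueness of translation invariant measure: after multiplication by the volume
    of the ball \<open>B\<close>, both sides are one double integral. In it, translating
    \<open>x\<close> by a \<open>T\<close>-preimage of \<open>y\<close> moves \<open>y\<close> from
    the argument of \<open>B\<close> to that of \<open>A\<close>. The ball serves as test set
    because \<open>T\<close> preserves it and its volume is positive and finite, so that it
    cancels.\<close>
  have "emeasure (distr lborel borel T) A * emeasure lborel B
      = (\<integral>\<^sup>+x. indicator A (T x) * (\<integral>\<^sup>+y. indicator B (y + (- T x)) \<partial>lborel) \<partial>lborel)"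
    by (subst transl) (simp_all add: nn_integral_multc emeasure_distr flip: nn_integral_distr[where T=T and M'=borel])
  also have "\<dots> = (\<integral>\<^sup>+x. (\<integral>\<^sup>+y. indicator A (T x) * indicator B (y - T x) \<partial>lborel) \<partial>lborel)"
    by (simp add: nn_integral_cmult)
  also have "\<dots> = (\<integral>\<^sup>+y. (\<integral>\<^sup>+x. indicator A (T x) * indicator B (y - T x) \<partial>lborel) \<partial>lborel)"
    by (rule lborel_pair.Fubini') measurable
  also have "\<dots> = (\<integral>\<^sup>+y. (\<integral>\<^sup>+x. indicator A (T x + y) * indicator B (- T x) \<partial>lborel) \<partial>lborel)"
  proof (rule nn_integral_cong)
    fix y :: 'a
    obtain c where c: "T c = y" using orthogonal_transformation_surj[OF T] by (metis surjD)
    show "(\<integral>\<^sup>+x. indicator A (T x) * indicator B (y - T x) \<partial>lborel)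
        = (\<integral>\<^sup>+x. indicator A (T x + y) * indicator B (- T x) \<partial>lborel)"
      by (subst transl[of _ c, symmetric]) (auto simp: add c)
  qed
  also have "\<dots> = (\<integral>\<^sup>+x. (\<integral>\<^sup>+y. indicator A (T x + y) * indicator B (- T x) \<partial>lborel) \<partial>lborel)"
    by (rule lborel_pair.Fubini') measurable
  also have "\<dots> = (\<integral>\<^sup>+x. (\<integral>\<^sup>+y. indicator A (y + T x) \<partial>lborel) * indicator B (- T x) \<partial>lborel)"
    by (simp add: nn_integral_multc add.commute)
  also have "\<dots> = (\<integral>\<^sup>+x. emeasure lborel A * indicator B x \<partial>lborel)"
    by (subst transl) (auto simp: indicator_def TB intro!: nn_integral_cong)
  also have "\<dots> = emeasure lborel A * emeasure lborel B" by (simp add: nn_integral_cmult)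
  finally have eq: "emeasure (distr lborel borel T) A * emeasure lborel B = emeasure lborel A * emeasure lborel B" .
  have "emeasure lborel B \<noteq> \<infinity>" using emeasure_lborel_ball_finite[of "0::'a" 1] by (simp add: B_def)
  moreover have "emeasure lborel B \<noteq> 0"
    unfolding B_def using unit_ball_vol_pos[of "DIM('a)"] by (subst emeasure_ball) (simp_all add: ennreal_eq_0_iff not_le)
  ultimately show "emeasure (distr lborel borel T) A = emeasure lborel A"
    using eq by (simp add: mult.commute[of _ "emeasure lborel B"] ennreal_mult_cancel_left)
qed

text \<open>The shifted strip from \<open>s\<close> to \<open>p + s\<close> is cut at
  \<open>p\<close>; its part beyond \<open>p\<close>, moved back by one period, fills the gap
  between \<open>0\<close> and \<open>s\<close>.\<close>

lemma emeasure_lborel_strip_shift: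
  fixes b :: "'a::euclidean_space" and p :: real
  assumes b: "b \<in> Basis" and P[measurable]: "P \<in> sets borel"
    and per: "\<And>x. x + p *\<^sub>R b \<in> P \<longleftrightarrow> x \<in> P" and s: "0 \<le> s" "s \<le> p"
  shows "emeasure lborel {x. 0 \<le> x \<bullet> b \<and> x \<bullet> b < p \<and> x + s *\<^sub>R b \<in> P}
       = emeasure lborel {x. 0 \<le> x \<bullet> b \<and> x \<bullet> b < p \<and> x \<in> P}"
proof -
  have bb: "b \<bullet> b = 1" using b by (simp add: inner_Basis)
  have transl: "emeasure lborel {x. x + c \<in> Q} = emeasure lborel Q"
    if [measurable]: "Q \<in> sets borel" for Q :: "'a set" and c
  proof -
    have "emeasure lborel Q = emeasure (distr lborel borel ((+) c)) Q"
      by (simp add: lborel_distr_plus)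
    also have "\<dots> = emeasure lborel {x. x + c \<in> Q}"
      by (subst emeasure_distr) (auto simp: vimage_def add.commute)
    finally show ?thesis by simp
  qed
  define Q where "Q \<alpha> \<beta> = {x. \<alpha> \<le> x \<bullet> b \<and> x \<bullet> b < \<beta> \<and> x \<in> P}" for \<alpha> \<beta>
  have Q[measurable]: "Q \<alpha> \<beta> \<in> sets borel" for \<alpha> \<beta>
    unfolding Q_def by measurable
  have "{x. 0 \<le> x \<bullet> b \<and> x \<bullet> b < p \<and> x + s *\<^sub>R b \<in> P} = {x. x + s *\<^sub>R b \<in> Q s (p + s)}"
    by (auto simp: Q_def inner_add_left bb)
  then have "emeasure lborel {x. 0 \<le> x \<bullet> b \<and> x \<bullet> b < p \<and> x + s *\<^sub>R b \<in> P} = emeasure lborel (Q s (p + s))"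
    by (simp add: transl)
  also have "Q s (p + s) = Q s p \<union> Q p (p + s)" using s by (auto simp: Q_def)
  also have "emeasure lborel \<dots> = emeasure lborel (Q s p) + emeasure lborel (Q p (p + s))"
    by (rule plus_emeasure[symmetric]) (auto simp: Q_def)
  also have "emeasure lborel (Q p (p + s)) = emeasure lborel {x. x + p *\<^sub>R b \<in> Q p (p + s)}"
    by (simp add: transl)
  also have "{x. x + p *\<^sub>R b \<in> Q p (p + s)} = Q 0 s"
    by (auto simp: Q_def inner_add_left bb per)
  also have "emeasure lborel (Q s p) + emeasure lborel (Q 0 s) = emeasure lborel (Q s p \<union> Q 0 s)"
    by (rule plus_emeasure) (auto simp: Q_def)
  also have "Q s p \<union> Q 0 s = Q 0 p" using s by (auto simp: Q_def)
  finally show ?thesis by (simp add: Q_def)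
qed

text \<open>In angle coordinates, multiplication of a torus point by a unimodular scalar is a
  translation along the diagonal. The diagonal is traversed one basis direction at a time in the
  half-open cube, which is a fundamental domain; the closed cube differs from it by a null
  set.\<close>

lemma emeasure_lborel_cube_shift:
  fixes P :: "'a::euclidean_space set" and p :: real
  assumes P[measurable]: "P \<in> sets borel"
    and per: "\<And>x b. b \<in> Basis \<Longrightarrow> x + p *\<^sub>R b \<in> P \<longleftrightarrow> x \<in> P" and s: "0 \<le> s" "s \<le> p"
  shows "emeasure lborel {x \<in> cbox 0 (p *\<^sub>R One). x + s *\<^sub>R One \<in> P}
       = emeasure lborel (cbox 0 (p *\<^sub>R One) \<inter> P)"
proof -
  have [measurable]: "(\<lambda>x::'a. x + c) \<in> borel_measurable borel" for c by measurable
  define D where "D = {x::'a. \<forall>b\<in>Basis. 0 \<le> x \<bullet> b \<and> x \<bullet> b < p}"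
  have half_open: "emeasure lborel (cbox 0 (p *\<^sub>R One) \<inter> Q) = emeasure lborel (D \<inter> Q)"
    if [measurable]: "Q \<in> sets borel" for Q
  proof (rule emeasure_eq_AE)
    have "AE x::'a in lborel. \<forall>b\<in>Basis. x \<bullet> b \<noteq> p"
      by (subst AE_finite_all) (auto intro: AE_lborel_inner_neq)
    then show "AE x in lborel. x \<in> cbox 0 (p *\<^sub>R One) \<inter> Q \<longleftrightarrow> x \<in> D \<inter> Q"
      by eventually_elim (auto simp: D_def cbox_def less_le)
    show "D \<inter> Q \<in> sets lborel" unfolding D_def by measurable
  qed simp
  have "emeasure lborel (D \<inter> {x. x + s *\<^sub>R \<Sum>J \<in> P}) = emeasure lborel (D \<inter> P)"
    if "finite J" "J \<subseteq> Basis" for J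
    using that
  proof (induction J rule: finite_induct)
    case (insert b J)
    then have b: "b \<in> Basis" by simp
    \<comment> \<open>\<open>P'\<close> gathers the constraints on the other coordinates and the
      shifts already treated. Moving along \<open>b\<close> leaves the former untouched, and
      \<open>P\<close> is periodic, so \<open>P'\<close> is periodic along \<open>b\<close> as the
      strip lemma demands.\<close>
    define P' where "P' = {x. (\<forall>c\<in>Basis - {b}. 0 \<le> x \<bullet> c \<and> x \<bullet> c < p) \<and> x + s *\<^sub>R \<Sum>J \<in> P}"
    have P'[measurable]: "P' \<in> sets borel" unfolding P'_def by measurable
    have orth: "(x + t *\<^sub>R b) \<bullet> c = x \<bullet> c" if "c \<in> Basis - {b}" for x c and t :: real
      using that b by (auto simp: inner_add_left inner_Basis)
    have per': "x + p *\<^sub>R b \<in> P' \<longleftrightarrow> x \<in> P'" for x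
      using per[OF b, of "x + s *\<^sub>R \<Sum>J"] by (auto simp: P'_def orth add_ac)
    have D_iff: "x \<in> D \<longleftrightarrow> 0 \<le> x \<bullet> b \<and> x \<bullet> b < p \<and> (\<forall>c\<in>Basis - {b}. 0 \<le> x \<bullet> c \<and> x \<bullet> c < p)" for x
      using b by (auto simp: D_def)
    have P'_iff: "x + s *\<^sub>R b \<in> P' \<longleftrightarrow>
        (\<forall>c\<in>Basis - {b}. 0 \<le> x \<bullet> c \<and> x \<bullet> c < p) \<and> x + s *\<^sub>R \<Sum>(insert b J) \<in> P" for x
    proof -
      have "(\<forall>c\<in>Basis - {b}. 0 \<le> (x + s *\<^sub>R b) \<bullet> c \<and> (x + s *\<^sub>R b) \<bullet> c < p)
         \<longleftrightarrow> (\<forall>c\<in>Basis - {b}. 0 \<le> x \<bullet> c \<and> x \<bullet> c < p)"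
        by (intro ball_cong refl) (simp only: orth)
      moreover have "x + s *\<^sub>R b + s *\<^sub>R \<Sum>J = x + s *\<^sub>R \<Sum>(insert b J)"
        using insert.hyps by (simp add: scaleR_add_right)
      ultimately show ?thesis by (simp only: P'_def mem_Collect_eq)
    qed
    have "D \<inter> {x. x + s *\<^sub>R \<Sum>(insert b J) \<in> P} = {x. 0 \<le> x \<bullet> b \<and> x \<bullet> b < p \<and> x + s *\<^sub>R b \<in> P'}"
      by (rule Set.set_eqI) (simp only: Int_iff mem_Collect_eq D_iff P'_iff conj_assoc)
    then have "emeasure lborel (D \<inter> {x. x + s *\<^sub>R \<Sum>(insert b J) \<in> P})
       = emeasure lborel {x. 0 \<le> x \<bullet> b \<and> x \<bullet> b < p \<and> x \<in> P'}"
      by (simp only: emeasure_lborel_strip_shift[OF b P' per' s])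
    also have "{x. 0 \<le> x \<bullet> b \<and> x \<bullet> b < p \<and> x \<in> P'} = D \<inter> {x. x + s *\<^sub>R \<Sum>J \<in> P}"
      by (rule Set.set_eqI) (simp only: Int_iff mem_Collect_eq D_iff P'_def conj_assoc)
    also have "emeasure lborel (D \<inter> {x. x + s *\<^sub>R \<Sum>J \<in> P}) = emeasure lborel (D \<inter> P)"
      using insert.IH insert.prems by blast
    finally show ?case .
  qed simp
  from this[of Basis] have "emeasure lborel (D \<inter> {x. x + s *\<^sub>R One \<in> P}) = emeasure lborel (D \<inter> P)"
    by simp
  moreover have "{x \<in> cbox 0 (p *\<^sub>R One). x + s *\<^sub>R One \<in> P} = cbox 0 (p *\<^sub>R One) \<inter> {x. x + s *\<^sub>R One \<in> P}"
    by blast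
  ultimately show ?thesis
    using half_open[of "{x. x + s *\<^sub>R One \<in> P}"] half_open[of P] by (simp only: P) simp
qed

section \<open>Square means over circles\<close>

lemma has_integral_cis_mult_cnj:
  "((\<lambda>t. cis t ^ j * cnj (cis t ^ k)) has_integral (if j = k then of_real (2 * pi) else 0)) {0..2 * pi}"
proof (cases "j = k")
  case True
  have "cis t ^ k * cnj (cis t ^ k) = 1" for t
    by (simp add: cis_cnj cis_mult flip: power_mult_distrib)
  then show ?thesis
    using True has_integral_const_real[of "1::complex" 0 "2 * pi"] by (simp add: scaleR_conv_of_real)
next
  case False
  define d where "d = real j - real k"
  have d: "d \<noteq> 0" using False by (simp add: d_def)
  have eq: "cis t ^ j * cnj (cis t ^ k) = cis (d * t)" for t
    by (simp add: d_def Complex.DeMoivre cis_cnj cis_mult algebra_simps)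
  have cis_exp: "cis (d * t) = exp (\<i> * of_real d * of_real t)" for t
    by (simp add: cis_conv_exp mult_ac)
  have deriv: "((\<lambda>t. cis (d * t) / (\<i> * d)) has_vector_derivative cis (d * t)) (at t within A)" for t A
    unfolding cis_exp
    by (rule has_vector_derivative_real_field) (use d in \<open>auto intro!: derivative_eq_intros\<close>)
  have "((\<lambda>t. cis (d * t)) has_integral (cis (d * (2 * pi)) / (\<i> * d) - cis (d * 0) / (\<i> * d))) {0..2 * pi}"
    by (rule fundamental_theorem_of_calculus) (auto intro: deriv)
  moreover have "cis (d * (2 * pi)) = 1"
    using cis_multiple_2pi[of d] by (simp add: d_def mult_ac)
  ultimately show ?thesis using False unfolding eq by simp
qed

text \<open>Absolute summability makes the partial sums converge uniformly on the circle, so the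
  finite Pythagorean identity passes to the limit under the integral. It is available in the
  application because the radii there are less than 1.\<close>

lemma parseval_power_series:
  fixes c :: "nat \<Rightarrow> complex"
  assumes c: "summable (\<lambda>k. cmod (c k))"
  shows "(\<lambda>k. 2 * pi * (cmod (c k))\<^sup>2) sums (integral {0..2 * pi} (\<lambda>t. (cmod (\<Sum>k. c k * cis t ^ k))\<^sup>2))"
    and "(\<lambda>t. (cmod (\<Sum>k. c k * cis t ^ k))\<^sup>2) integrable_on {0..2 * pi}"
proof -
  define P where "P n t = (\<Sum>k<n. c k * cis t ^ k)" for n t
  define Q where "Q t = (\<Sum>k. c k * cis t ^ k)" for t
  have unif: "uniform_limit {0..2 * pi} P Q sequentially"
    unfolding P_def[abs_def] Q_def[abs_def]
    by (rule Weierstrass_m_test[OF _ c]) (simp add: norm_mult norm_power)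
  have contP: "continuous_on {0..2 * pi} (P n)" for n
    unfolding P_def[abs_def] by (intro continuous_intros)
  have contQ: "continuous_on {0..2 * pi} Q"
    by (rule uniform_limit_theorem[OF _ unif]) (auto simp: contP)
  have bQ: "bounded (Q ` {0..2 * pi})"
    using contQ by (auto intro!: compact_imp_bounded compact_continuous_image)
  have "uniform_limit {0..2 * pi} (\<lambda>n t. P n t * cnj (P n t)) (\<lambda>t. Q t * cnj (Q t)) sequentially"
  proof (rule uniform_lim_mult)
    show "uniform_limit {0..2 * pi} (\<lambda>n t. cnj (P n t)) (\<lambda>t. cnj (Q t)) sequentially"
      using unif unfolding uniform_limit_iff by (simp add: dist_norm flip: complex_cnj_diff)
    show "bounded ((\<lambda>t. cnj (Q t)) ` {0..2*pi})"
      using bQ by (simp add: bounded_iff)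
  qed (use unif bQ in auto)
  then have "uniform_limit {0..2 * pi} (\<lambda>n t. Re (P n t * cnj (P n t))) (\<lambda>t. Re (Q t * cnj (Q t))) sequentially"
    by (rule bounded_linear.uniform_limit[OF bounded_linear_Re])
  then have unif2: "uniform_limit {0..2 * pi} (\<lambda>n t. (cmod (P n t))\<^sup>2) (\<lambda>t. (cmod (Q t))\<^sup>2) sequentially"
    by (simp flip: complex_norm_square of_real_power)
  have int: "((\<lambda>t. (cmod (P n t))\<^sup>2) has_integral (\<Sum>k<n. 2 * pi * (cmod (c k))\<^sup>2)) {0..2 * pi}" for n
  proof -
    have "((\<lambda>t. \<Sum>j<n. \<Sum>k<n. (c j * cnj (c k)) * (cis t ^ j * cnj (cis t ^ k))) has_integral
        (\<Sum>j<n. \<Sum>k<n. (c j * cnj (c k)) * (if j = k then of_real (2 * pi) else 0))) {0..2 * pi}"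
      by (intro has_integral_sum has_integral_mult_right has_integral_cis_mult_cnj finite_lessThan)
    moreover have "(\<Sum>j<n. \<Sum>k<n. (c j * cnj (c k)) * (cis t ^ j * cnj (cis t ^ k))) = P n t * cnj (P n t)" for t
      by (simp add: P_def sum_product algebra_simps)
    moreover have "(\<Sum>j<n. \<Sum>k<n. (c j * cnj (c k)) * (if j = k then of_real (2 * pi) else 0))
       = of_real (\<Sum>k<n. 2 * pi * (cmod (c k))\<^sup>2)"
      by (simp add: if_distrib sum.delta mult_ac flip: complex_norm_square cong: if_cong)
    ultimately have "((\<lambda>t. P n t * cnj (P n t)) has_integral of_real (\<Sum>k<n. 2 * pi * (cmod (c k))\<^sup>2)) {0..2 * pi}"
      by simp
    from has_integral_linear[OF this bounded_linear_Re] show ?thesis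
      by (simp add: o_def del: of_real_sum flip: complex_norm_square of_real_power)
  qed
  obtain I J where I: "\<And>n. ((\<lambda>t. (cmod (P n t))\<^sup>2) has_integral I n) {0..2 * pi}"
    and J: "((\<lambda>t. (cmod (Q t))\<^sup>2) has_integral J) {0..2 * pi}" and lim: "I \<longlonglongrightarrow> J"
    by (rule uniform_limit_integral[OF unif2]) (auto intro!: continuous_intros contP)
  have "I = (\<lambda>n. \<Sum>k<n. 2 * pi * (cmod (c k))\<^sup>2)"
    using has_integral_unique[OF I int] by (rule ext)
  then have "(\<lambda>k. 2 * pi * (cmod (c k))\<^sup>2) sums J"
    using lim by (simp add: sums_def)
  then show "(\<lambda>k. 2 * pi * (cmod (c k))\<^sup>2) sums (integral {0..2 * pi} (\<lambda>t. (cmod (\<Sum>k. c k * cis t ^ k))\<^sup>2))"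
    using integral_unique[OF J] by (simp add: Q_def)
  show "(\<lambda>t. (cmod (\<Sum>k. c k * cis t ^ k))\<^sup>2) integrable_on {0..2 * pi}"
    using J by (auto simp: Q_def integrable_on_def)
qed

text \<open>Both relations are coefficientwise in the Taylor coefficients \<open>c\<^sub>k\<close> of \<open>\<phi>\<close>: the circle mean of
  \<open>|\<phi>|\<^sup>2\<close> over radius \<open>r\<close> is \<open>\<Sum> r\<^bsup>2k\<^esup> |c\<^sub>k|\<^sup>2\<close>, and \<open>(r\<^sup>k - s\<^sup>k)\<^sup>2 = r\<^bsup>2k\<^esup> + s\<^bsup>2k\<^esup> - 2 (rs)\<^sup>k\<close>.\<close>

lemma circle_mean_square:
  fixes \<phi> :: "complex \<Rightarrow> complex"
  assumes hol: "\<phi> holomorphic_on ball 0 1"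
    and r: "0 < r" "r < 1" and s: "0 < s" "s < 1"
  defines "A \<equiv> \<lambda>r. \<integral>\<^sup>+t. ennreal ((cmod (\<phi> (r * cis t)))\<^sup>2) * indicator {0..2 * pi} t \<partial>lborel"
  shows "r \<le> s \<Longrightarrow> A r \<le> A s"
    and "(\<integral>\<^sup>+t. ennreal ((cmod (\<phi> (r * cis t) - \<phi> (s * cis t)))\<^sup>2) * indicator {0..2 * pi} t \<partial>lborel)
          + 2 * A (sqrt (r * s)) = A r + A s"
proof -
  define c where "c k = (deriv ^^ k) \<phi> 0 / fact k" for k
  have taylor: "(\<lambda>k. c k * w ^ k) sums \<phi> w" if "cmod w < 1" for w
    using holomorphic_power_series[OF hol, of w] that by (simp add: c_def dist_norm)
  have abs: "summable (\<lambda>k. cmod (c k * of_real r ^ k))" if "0 < r" "r < 1" for r :: real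
  proof -
    have "summable (\<lambda>k. norm (c k * of_real r ^ k))"
    proof (rule powser_insidea)
      \<comment> \<open>The midpoint of \<open>r\<close> and 1 lies in the disc and farther out than
        \<open>r\<close>; convergence there gives absolute convergence at \<open>r\<close>.\<close>
      show "summable (\<lambda>k. c k * of_real ((1 + r) / 2) ^ k)"
        using taylor[of "of_real ((1 + r) / 2)"] that by (auto simp: sums_iff norm_of_real simp del: of_real_divide of_real_add)
      show "norm (of_real r :: complex) < norm (of_real ((1 + r) / 2) :: complex)"
        using that by (simp add: norm_of_real del: of_real_divide of_real_add)
    qed
    then show ?thesis .
  qed
  have nn: "(\<integral>\<^sup>+t. ennreal ((cmod (\<Sum>k. d k * cis t ^ k))\<^sup>2) * indicator {0..2 * pi} t \<partial>lborel)
      = ennreal (\<Sum>k. 2 * pi * (cmod (d k))\<^sup>2)" and sm: "summable (\<lambda>k. 2 * pi * (cmod (d k))\<^sup>2)"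
    if "summable (\<lambda>k. cmod (d k))" for d
  proof -
    note p = parseval_power_series[OF that]
    show "(\<integral>\<^sup>+t. ennreal ((cmod (\<Sum>k. d k * cis t ^ k))\<^sup>2) * indicator {0..2 * pi} t \<partial>lborel)
      = ennreal (\<Sum>k. 2 * pi * (cmod (d k))\<^sup>2)"
      using p by (subst nn_integral_has_integral_lebesgue') (auto simp: has_integral_integral sums_iff)
    show "summable (\<lambda>k. 2 * pi * (cmod (d k))\<^sup>2)" using p by (auto simp: sums_iff)
  qed
  have val: "\<phi> (of_real r * cis t) = (\<Sum>k. (c k * of_real r ^ k) * cis t ^ k)" if "0 < r" "r < 1" for r t
    using taylor[of "of_real r * cis t"] that
    by (simp add: norm_mult sums_iff power_mult_distrib mult_ac)
  define a where "a r k = 2 * pi * (cmod (c k * of_real r ^ k))\<^sup>2" for r k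
  have A: "A r = ennreal (\<Sum>k. a r k)" and sa: "summable (a r)" if "0 < r" "r < 1" for r
    using nn[OF abs[OF that]] sm[OF abs[OF that]] that by (simp_all add: A_def val a_def[abs_def])
  show "A r \<le> A s" if "r \<le> s"
    using r s that unfolding A[OF r] A[OF s]
    by (intro ennreal_leI suminf_le sa) (auto simp: a_def norm_mult norm_power intro!: power_mono mult_left_mono)
  define q where "q = sqrt (r * s)"
  have q: "0 < q" "q < 1" "q\<^sup>2 = r * s"
    using r s by (auto simp: q_def real_sqrt_less_iff mult_strict_mono[of r 1 s 1, simplified])
  define b where "b k = 2 * pi * (cmod (c k * of_real r ^ k - c k * of_real s ^ k))\<^sup>2" for k
  have absb: "summable (\<lambda>k. cmod (c k * of_real r ^ k - c k * of_real s ^ k))"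
    by (rule summable_comparison_test'[OF summable_add[OF abs[OF r] abs[OF s]]])
       (simp add: norm_triangle_ineq4)
  have diff: "\<phi> (of_real r * cis t) - \<phi> (of_real s * cis t) =
      (\<Sum>k. (c k * of_real r ^ k - c k * of_real s ^ k) * cis t ^ k)" for t
  proof -
    have "summable (\<lambda>k. c k * of_real r ^ k * cis t ^ k)" if "0 < r" "r < 1" for r
      by (rule summable_norm_cancel) (use abs[OF that] in \<open>simp add: norm_mult norm_power\<close>)
    from this[OF r] this[OF s] show ?thesis
      unfolding val[OF r] val[OF s] by (simp add: suminf_diff algebra_simps)
  qed
  have sb: "summable b" using sm[OF absb] by (simp add: b_def[abs_def])
  have bk: "b k + 2 * a q k = a r k + a s k" for k
  proof -
    have b_eq: "b k = 2 * pi * ((cmod (c k))\<^sup>2 * (r ^ k - s ^ k)\<^sup>2)"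
    proof -
      have "c k * of_real r ^ k - c k * of_real s ^ k = c k * of_real (r ^ k - s ^ k)"
        by (simp add: algebra_simps)
      then show ?thesis by (simp add: b_def norm_mult power_mult_distrib del: of_real_diff of_real_power)
    qed
    have a_eq: "a x k = 2 * pi * ((cmod (c k))\<^sup>2 * (x ^ k)\<^sup>2)" if "0 < x" for x
      using that by (simp add: a_def norm_mult norm_power power_mult_distrib)
    have "(q ^ k)\<^sup>2 = r ^ k * s ^ k"
      by (metis q(3) power_mult power_mult_distrib mult.commute)
    then show ?thesis
      by (simp add: b_eq a_eq[OF q(1)] a_eq[OF r(1)] a_eq[OF s(1)] power2_diff algebra_simps)
  qed
  have "(\<Sum>k. b k) + 2 * (\<Sum>k. a q k) = (\<Sum>k. b k + 2 * a q k)"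
    using sb sa[OF q(1,2)] by (simp add: suminf_mult summable_mult flip: suminf_add)
  also have "\<dots> = (\<Sum>k. a r k) + (\<Sum>k. a s k)"
    using sa[OF r] sa[OF s] by (simp add: bk flip: suminf_add)
  finally have sums: "(\<Sum>k. b k) + 2 * (\<Sum>k. a q k) = (\<Sum>k. a r k) + (\<Sum>k. a s k)" .
  have nonneg: "0 \<le> (\<Sum>k. b k)" "0 \<le> (\<Sum>k. a q k)" "0 \<le> (\<Sum>k. a r k)" "0 \<le> (\<Sum>k. a s k)"
    by (intro suminf_nonneg sb sa r s q(1,2); simp add: a_def b_def)+
  have "(\<integral>\<^sup>+t. ennreal ((cmod (\<phi> (r * cis t) - \<phi> (s * cis t)))\<^sup>2) * indicator {0..2 * pi} t \<partial>lborel)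
      + 2 * A q = ennreal (\<Sum>k. b k) + 2 * ennreal (\<Sum>k. a q k)"
    using nn[OF absb] by (simp add: diff b_def A[OF q(1,2)])
  also have "\<dots> = ennreal ((\<Sum>k. b k) + 2 * (\<Sum>k. a q k))"
    using nonneg by (simp add: ennreal_mult)
  also have "\<dots> = A r + A s"
    unfolding sums A[OF r] A[OF s] using nonneg by (simp add: ennreal_plus)
  finally show "(\<integral>\<^sup>+t. ennreal ((cmod (\<phi> (r * cis t) - \<phi> (s * cis t)))\<^sup>2) * indicator {0..2 * pi} t \<partial>lborel)
          + 2 * A (sqrt (r * s)) = A r + A s"
    unfolding q_def .
qed

section \<open>Limits in the square norm\<close>

text \<open>Values in \<open>[0, \<infinity>]\<close> allow estimates before integrability is known.
  Square roots are not taken, since the relations between radii are relations between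
  squares.\<close>

abbreviation sqnorm :: "'a measure \<Rightarrow> ('a \<Rightarrow> complex) \<Rightarrow> ennreal" where
  "sqnorm M f \<equiv> \<integral>\<^sup>+x. ennreal ((cmod (f x))\<^sup>2) \<partial>M"

text \<open>The Riesz-Fischer argument for a family indexed by radii: a rapidly Cauchy sequence of
  radii yields an almost everywhere limit, and Fatou's lemma carries the Cauchy estimate over to
  that limit.\<close>

lemma L2_cauchy_at_left_converges:
  fixes u :: "real \<Rightarrow> 'a \<Rightarrow> complex"
  assumes meas: "\<And>r. r \<in> {0<..<1} \<Longrightarrow> u r \<in> borel_measurable M"
    and cauchy: "\<And>\<epsilon>::real. 0 < \<epsilon> \<Longrightarrow> \<exists>q\<in>{0<..<1}. \<forall>r\<in>{q<..<1}. \<forall>s\<in>{q<..<1}.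
        (\<integral>\<^sup>+x. ennreal ((cmod (u r x - u s x))\<^sup>2) \<partial>M) \<le> ennreal \<epsilon>"
  obtains g where "g \<in> borel_measurable M"
    "((\<lambda>r. \<integral>\<^sup>+x. ennreal ((cmod (u r x - g x))\<^sup>2) \<partial>M) \<longlongrightarrow> 0) (at_left 1)"
proof -
  have "\<forall>n. \<exists>q\<in>{0<..<1}. \<forall>r\<in>{q<..<1}. \<forall>s\<in>{q<..<1}.
        (\<integral>\<^sup>+x. ennreal ((cmod (u r x - u s x))\<^sup>2) \<partial>M) \<le> ennreal ((1/4) ^ n)"
    using cauchy by simp
  then obtain q where q: "\<And>n. q n \<in> {0<..<1}"
    and qle: "\<And>n r s. r \<in> {q n<..<1} \<Longrightarrow> s \<in> {q n<..<1} \<Longrightarrow>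
        (\<integral>\<^sup>+x. ennreal ((cmod (u r x - u s x))\<^sup>2) \<partial>M) \<le> ennreal ((1/4) ^ n)"
    by metis
  \<comment> \<open>Halfway between 1 and the largest of the first thresholds, \<open>t n\<close>
    lies beyond every \<open>q k\<close> with \<open>k \<le> n\<close>, whether or not
    \<open>q\<close> increases.\<close>
  define t where "t n = (1 + Max (q ` {..n})) / 2" for n
  have t: "t n \<in> {q k<..<1}" if "k \<le> n" for k n
  proof -
    have "q k \<le> Max (q ` {..n})" using that by (intro Max_ge) auto
    moreover have "Max (q ` {..n}) < 1" using q by (subst Max_less_iff) auto
    moreover have "a < (1 + b) / 2 \<and> (1 + b) / 2 < 1" if "a \<le> b" "b < 1" for a b :: real
      using that by auto
    ultimately have "q k < (1 + Max (q ` {..n})) / 2 \<and> (1 + Max (q ` {..n})) / 2 < 1" by blast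
    then show ?thesis unfolding t_def greaterThanLessThan_iff .
  qed
  have t01: "t n \<in> {0<..<1}" for n using t[of 0 n] q[of 0] by auto
  define v where "v n = u (t n)" for n
  have [measurable]: "v n \<in> borel_measurable M" for n
    using meas[OF t01] by (simp add: v_def)
  define g where "g x = lim (\<lambda>n. v n x)" for x
  have g[measurable]: "g \<in> borel_measurable M"
    unfolding g_def[abs_def] by (rule borel_measurable_lim_metric) measurable
  have lim: "AE x in M. (\<lambda>n. v n x) \<longlonglongrightarrow> g x"
  proof -
    \<comment> \<open>The weight \<open>2 ^ n\<close> against the bound \<open>(1/4) ^ n\<close>
      leaves a convergent series. Where \<open>S\<close> is finite, the steps of the sequence are at
      most a constant times \<open>sqrt (1/2) ^ n\<close>, so the telescoping sum converges.\<close>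
    define S where "S x = (\<Sum>n. ennreal (2 ^ n) * ennreal ((cmod (v (Suc n) x - v n x))\<^sup>2))" for x
    have S[measurable]: "S \<in> borel_measurable M" unfolding S_def[abs_def] by measurable
    have "(\<integral>\<^sup>+x. S x \<partial>M) = (\<Sum>n. ennreal (2 ^ n) * (\<integral>\<^sup>+x. ennreal ((cmod (v (Suc n) x - v n x))\<^sup>2) \<partial>M))"
      unfolding S_def by (subst nn_integral_suminf) (auto simp: nn_integral_cmult)
    also have "\<dots> \<le> (\<Sum>n. ennreal ((1/2) ^ n))"
    proof (rule suminf_le)
      fix n
      have "ennreal (2 ^ n) * (\<integral>\<^sup>+x. ennreal ((cmod (v (Suc n) x - v n x))\<^sup>2) \<partial>M)
          \<le> ennreal (2 ^ n) * ennreal ((1/4) ^ n)"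
        unfolding v_def by (intro mult_left_mono qle t) auto
      also have "\<dots> = ennreal ((1/2) ^ n)"
        by (simp flip: ennreal_mult power_mult_distrib)
      finally show "ennreal (2 ^ n) * (\<integral>\<^sup>+x. ennreal ((cmod (v (Suc n) x - v n x))\<^sup>2) \<partial>M) \<le> ennreal ((1/2) ^ n)" .
    qed auto
    also have "\<dots> = ennreal (\<Sum>n. (1/2) ^ n)"
      by (intro suminf_ennreal2) auto
    also have "\<dots> < \<infinity>" by simp
    finally have "AE x in M. S x \<noteq> \<infinity>"
      by (intro nn_integral_noteq_infinite) auto
    then show ?thesis
    proof eventually_elim
      case (elim x)
      then obtain C where C: "S x = ennreal C" "0 \<le> C" by (cases "S x") auto
      have bound: "cmod (v (Suc n) x - v n x) \<le> sqrt C * (sqrt (1/2)) ^ n" for n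
      proof -
        have "ennreal (2 ^ n * (cmod (v (Suc n) x - v n x))\<^sup>2) \<le> S x"
          using sum_le_suminf[OF summableI, of "{n}" "\<lambda>n. ennreal (2 ^ n) * ennreal ((cmod (v (Suc n) x - v n x))\<^sup>2)"]
          by (simp add: S_def ennreal_mult)
        then have "2 ^ n * (cmod (v (Suc n) x - v n x))\<^sup>2 \<le> C" using C by simp
        then have "(cmod (v (Suc n) x - v n x))\<^sup>2 \<le> C * (1/2) ^ n"
          by (simp add: field_simps)
        then have "sqrt ((cmod (v (Suc n) x - v n x))\<^sup>2) \<le> sqrt (C * (1/2) ^ n)"
          by (rule real_sqrt_le_mono)
        then show ?thesis by (simp add: real_sqrt_mult real_sqrt_power)
      qed
      have "summable (\<lambda>n. v (Suc n) x - v n x)"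
      proof (rule summable_comparison_test')
        show "summable (\<lambda>n. sqrt C * (sqrt (1/2)) ^ n)"
          by (intro summable_mult summable_geometric) (simp add: real_sqrt_lt_1_iff)
      qed (use bound in auto)
      then have "convergent (\<lambda>n. \<Sum>k<n. v (Suc k) x - v k x)"
        by (simp add: summable_iff_convergent)
      then have "convergent (\<lambda>n. v n x - v 0 x)"
        by (simp only: sum_lessThan_telescope[of "\<lambda>n. v n x"])
      then obtain l where "(\<lambda>n. v n x - v 0 x) \<longlonglongrightarrow> l" by (auto simp: convergent_def)
      from tendsto_add[OF this tendsto_const[of "v 0 x"]] have "convergent (\<lambda>n. v n x)"
        by (auto simp: convergent_def)
      then show "(\<lambda>n. v n x) \<longlonglongrightarrow> g x"
        unfolding g_def by (simp add: convergent_LIMSEQ_iff)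
    qed
  qed
  \<comment> \<open>The estimate concerns every \<open>r\<close> beyond \<open>q k\<close> and not
    only the chosen radii \<open>t n\<close>; this gives convergence of the whole family.\<close>
  have fatou: "(\<integral>\<^sup>+x. ennreal ((cmod (u r x - g x))\<^sup>2) \<partial>M) \<le> ennreal ((1/4) ^ k)" if r: "r \<in> {q k<..<1}" for r k
  proof -
    have [measurable]: "u r \<in> borel_measurable M" using r q[of k] by (intro meas) auto
    have "(\<integral>\<^sup>+x. ennreal ((cmod (u r x - g x))\<^sup>2) \<partial>M)
        = (\<integral>\<^sup>+x. liminf (\<lambda>n. ennreal ((cmod (u r x - v n x))\<^sup>2)) \<partial>M)"
    proof (rule nn_integral_cong_AE)
      show "AE x in M. ennreal ((cmod (u r x - g x))\<^sup>2) = liminf (\<lambda>n. ennreal ((cmod (u r x - v n x))\<^sup>2))"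
        using lim
      proof eventually_elim
        case (elim x)
        then have "(\<lambda>n. ennreal ((cmod (u r x - v n x))\<^sup>2)) \<longlonglongrightarrow> ennreal ((cmod (u r x - g x))\<^sup>2)"
          by (intro tendsto_intros)
        then show ?case by (rule lim_imp_Liminf[OF sequentially_bot, symmetric])
      qed
    qed
    also have "\<dots> \<le> liminf (\<lambda>n. \<integral>\<^sup>+x. ennreal ((cmod (u r x - v n x))\<^sup>2) \<partial>M)"
      by (rule nn_integral_liminf) measurable
    also have "\<dots> \<le> ennreal ((1/4) ^ k)"
    proof (rule Liminf_le)
      show "\<forall>\<^sub>F n in sequentially. (\<integral>\<^sup>+x. ennreal ((cmod (u r x - v n x))\<^sup>2) \<partial>M) \<le> ennreal ((1/4) ^ k)"
        using eventually_ge_at_top[of k] by eventually_elim (use r in \<open>auto simp: v_def intro!: qle t\<close>)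
    qed simp
    finally show ?thesis .
  qed
  have "((\<lambda>r. \<integral>\<^sup>+x. ennreal ((cmod (u r x - g x))\<^sup>2) \<partial>M) \<longlongrightarrow> 0) (at_left 1)"
  proof (rule order_tendstoI)
    fix a :: ennreal assume "0 < a"
    have "(\<lambda>k. ennreal ((1/4) ^ k)) \<longlonglongrightarrow> ennreal 0"
      by (intro tendsto_ennrealI LIMSEQ_power_zero) simp
    then have "\<forall>\<^sub>F k in sequentially. ennreal ((1/4) ^ k) < a"
      using \<open>0 < a\<close> by (intro order_tendstoD) auto
    then obtain k where k: "ennreal ((1/4) ^ k) < a" by (auto simp: eventually_sequentially)
    have "\<forall>\<^sub>F r in at_left 1. r \<in> {q k<..<1}"
      using q[of k] by (intro eventually_at_leftI[of "q k"]) auto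
    then show "\<forall>\<^sub>F r in at_left 1. (\<integral>\<^sup>+x. ennreal ((cmod (u r x - g x))\<^sup>2) \<partial>M) < a"
      by eventually_elim (use fatou k in \<open>auto intro: le_less_trans\<close>)
  qed simp
  with g that show thesis by blast
qed

text \<open>Expanding the square of \<open>\<delta> * norm a - norm b\<close> bounds the mixed term.
  With small \<open>\<delta>\<close> the factor of the main term is close to 1, which replaces
  Minkowski's inequality for squared norms; \<open>\<delta> = 1\<close> is the crude version with
  factors 2.\<close>

lemma norm_add_power2_le:
  fixes a b :: "'a::real_normed_vector"
  assumes "0 < \<delta>"
  shows "(norm (a + b))\<^sup>2 \<le> (1 + \<delta>) * (norm a)\<^sup>2 + (1 + 1 / \<delta>) * (norm b)\<^sup>2"
proof -
  have "0 \<le> (\<delta> * norm a - norm b)\<^sup>2 / \<delta>" using assms by simp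
  also have "\<dots> = \<delta> * (norm a)\<^sup>2 + (norm b)\<^sup>2 / \<delta> - 2 * norm a * norm b"
    using assms by (simp add: power2_eq_square field_simps)
  finally have "2 * norm a * norm b \<le> \<delta> * (norm a)\<^sup>2 + (norm b)\<^sup>2 / \<delta>" by simp
  moreover have "(norm (a + b))\<^sup>2 \<le> (norm a + norm b)\<^sup>2"
    by (intro power_mono norm_triangle_ineq) simp
  ultimately show ?thesis by (simp add: power2_sum algebra_simps)
qed

lemma sqnorm_add_le:
  assumes [measurable]: "f \<in> borel_measurable M" "g \<in> borel_measurable M" and \<delta>: "0 < \<delta>"
  shows "sqnorm M (\<lambda>x. f x + g x) \<le> ennreal (1 + \<delta>) * sqnorm M f + ennreal (1 + 1 / \<delta>) * sqnorm M g"
proof -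
  have "sqnorm M (\<lambda>x. f x + g x)
      \<le> (\<integral>\<^sup>+x. ennreal (1 + \<delta>) * ennreal ((cmod (f x))\<^sup>2) + ennreal (1 + 1 / \<delta>) * ennreal ((cmod (g x))\<^sup>2) \<partial>M)"
  proof (rule nn_integral_mono)
    fix x
    have "ennreal ((cmod (f x + g x))\<^sup>2) \<le> ennreal ((1 + \<delta>) * (cmod (f x))\<^sup>2 + (1 + 1 / \<delta>) * (cmod (g x))\<^sup>2)"
      by (intro ennreal_leI norm_add_power2_le \<delta>)
    also have "\<dots> = ennreal (1 + \<delta>) * ennreal ((cmod (f x))\<^sup>2) + ennreal (1 + 1 / \<delta>) * ennreal ((cmod (g x))\<^sup>2)"
      using \<delta> by (subst ennreal_plus) (auto simp: ennreal_mult simp del: ennreal_plus)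
    finally show "ennreal ((cmod (f x + g x))\<^sup>2) \<le> \<dots>" .
  qed
  also have "\<dots> = ennreal (1 + \<delta>) * sqnorm M f + ennreal (1 + 1 / \<delta>) * sqnorm M g"
    by (simp add: nn_integral_add nn_integral_cmult del: ennreal_plus)
  finally show ?thesis .
qed

lemma sqnorm_cmult:
  assumes [measurable]: "f \<in> borel_measurable M"
  shows "sqnorm M (\<lambda>x. c * f x) = ennreal ((cmod c)\<^sup>2) * sqnorm M f"
  by (simp add: norm_mult power_mult_distrib ennreal_mult nn_integral_cmult)

lemma sqnorm_minus_commute: "sqnorm M (\<lambda>x. f x - g x) = sqnorm M (\<lambda>x. g x - f x)"
  by (simp add: norm_minus_commute)

lemma ennreal_le_if_scaled_le:
  assumes "\<And>\<delta>::real. 0 < \<delta> \<Longrightarrow> a \<le> ennreal (1 + \<delta>) * b"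
  shows "a \<le> b"
proof (rule tendsto_lowerbound)
  have "(\<lambda>n. ennreal (1 + 1 / real (Suc n))) \<longlonglongrightarrow> ennreal (1 + 0)"
    by (intro tendsto_ennrealI tendsto_add tendsto_const) (rule LIMSEQ_Suc, rule lim_1_over_n)
  then have "(\<lambda>n. ennreal (1 + 1 / real (Suc n)) * b) \<longlonglongrightarrow> ennreal (1 + 0) * b"
    by (intro tendsto_mult_ennreal) auto
  then show "(\<lambda>n. ennreal (1 + 1 / real (Suc n)) * b) \<longlonglongrightarrow> b" by simp
  show "\<forall>\<^sub>F n in sequentially. a \<le> ennreal (1 + 1 / real (Suc n)) * b"
    using assms by (intro always_eventually) simp
qed simp

text \<open>Continuity of the squared norm. In both directions \<open>\<delta>\<close> is fixed
  while \<open>r\<close> moves, so the difference term disappears in spite of its large factor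
  \<open>1 + 1 / \<delta>\<close>; only then does \<open>\<delta>\<close> tend to 0.\<close>

lemma sqnorm_tendsto_unique:
  assumes F: "F \<noteq> bot" and meas: "\<forall>\<^sub>F r in F. u r \<in> borel_measurable M" "g \<in> borel_measurable M"
    and lim: "((\<lambda>r. sqnorm M (\<lambda>x. u r x - g x)) \<longlongrightarrow> 0) F" "((\<lambda>r. sqnorm M (u r)) \<longlongrightarrow> L) F"
  shows "sqnorm M g = L"
proof (rule antisym)
  note [measurable] = meas(2)
  have lim': "((\<lambda>r. ennreal (1 + 1 / \<delta>) * sqnorm M (\<lambda>x. u r x - g x)) \<longlongrightarrow> ennreal (1 + 1 / \<delta>) * 0) F" for \<delta> :: real
    using lim(1) by (intro tendsto_mult_ennreal) auto
  show "sqnorm M g \<le> L"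
  proof (rule ennreal_le_if_scaled_le)
    fix \<delta> :: real assume \<delta>: "0 < \<delta>"
    have "((\<lambda>r. ennreal (1 + \<delta>) * sqnorm M (u r) + ennreal (1 + 1 / \<delta>) * sqnorm M (\<lambda>x. u r x - g x)) \<longlongrightarrow>
        ennreal (1 + \<delta>) * L + ennreal (1 + 1 / \<delta>) * 0) F"
      using \<delta> lim(2) by (intro tendsto_add lim' tendsto_mult_ennreal) auto
    moreover have "\<forall>\<^sub>F r in F. sqnorm M g
       \<le> ennreal (1 + \<delta>) * sqnorm M (u r) + ennreal (1 + 1 / \<delta>) * sqnorm M (\<lambda>x. u r x - g x)"
      using meas(1)
    proof eventually_elim
      case (elim r)
      note [measurable] = elim
      have "sqnorm M (\<lambda>x. u r x + (g x - u r x))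
        \<le> ennreal (1 + \<delta>) * sqnorm M (u r) + ennreal (1 + 1 / \<delta>) * sqnorm M (\<lambda>x. g x - u r x)"
        by (intro sqnorm_add_le \<delta>) measurable
      then show ?case by (simp add: norm_minus_commute)
    qed
    ultimately have "sqnorm M g \<le> ennreal (1 + \<delta>) * L + ennreal (1 + 1 / \<delta>) * 0"
      using F by (rule tendsto_lowerbound)
    then show "sqnorm M g \<le> ennreal (1 + \<delta>) * L" by simp
  qed
  show "L \<le> sqnorm M g"
  proof (rule ennreal_le_if_scaled_le)
    fix \<delta> :: real assume \<delta>: "0 < \<delta>"
    have "((\<lambda>r. ennreal (1 + \<delta>) * sqnorm M g + ennreal (1 + 1 / \<delta>) * sqnorm M (\<lambda>x. u r x - g x)) \<longlongrightarrow>
        ennreal (1 + \<delta>) * sqnorm M g + ennreal (1 + 1 / \<delta>) * 0) F"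
      by (intro tendsto_add lim' tendsto_const)
    moreover have "\<forall>\<^sub>F r in F. sqnorm M (u r)
       \<le> ennreal (1 + \<delta>) * sqnorm M g + ennreal (1 + 1 / \<delta>) * sqnorm M (\<lambda>x. u r x - g x)"
      using meas(1)
    proof eventually_elim
      case (elim r)
      note [measurable] = elim
      have "sqnorm M (\<lambda>x. g x + (u r x - g x))
        \<le> ennreal (1 + \<delta>) * sqnorm M g + ennreal (1 + 1 / \<delta>) * sqnorm M (\<lambda>x. u r x - g x)"
        by (intro sqnorm_add_le \<delta>) measurable
      then show ?case by simp
    qed
    ultimately have "L \<le> ennreal (1 + \<delta>) * sqnorm M g + ennreal (1 + 1 / \<delta>) * 0"
      using lim(2) F by (intro tendsto_le[of F]) auto
    then show "L \<le> ennreal (1 + \<delta>) * sqnorm M g" by simp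
  qed
qed

text \<open>Uniqueness of square-norm limits up to null sets, in the form needed for linearity of
  the embedding: \<open>h\<close> and the combination of \<open>f\<close> and \<open>g\<close> are
  limits of the same family.\<close>

lemma sqnorm_limit_lincomb:
  assumes F: "F \<noteq> bot"
    and meas: "\<forall>\<^sub>F r in F. u r \<in> borel_measurable M" "\<forall>\<^sub>F r in F. v r \<in> borel_measurable M"
      "f \<in> borel_measurable M" "g \<in> borel_measurable M" "h \<in> borel_measurable M"
    and lim: "((\<lambda>r. sqnorm M (\<lambda>x. u r x - f x)) \<longlongrightarrow> 0) F" "((\<lambda>r. sqnorm M (\<lambda>x. v r x - g x)) \<longlongrightarrow> 0) F"
      "((\<lambda>r. sqnorm M (\<lambda>x. (a * u r x + b * v r x) - h x)) \<longlongrightarrow> 0) F"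
  shows "AE x in M. h x = a * f x + b * g x"
proof -
  note [measurable] = meas(3-5)
  define k where "k x = (h x - a * f x) - b * g x" for x
  have [measurable]: "k \<in> borel_measurable M" unfolding k_def[abs_def] by measurable
  have "((\<lambda>r. 2 * sqnorm M (\<lambda>x. (a * u r x + b * v r x) - h x) +
      2 * (2 * (ennreal ((cmod a)\<^sup>2) * sqnorm M (\<lambda>x. u r x - f x)) + 2 * (ennreal ((cmod b)\<^sup>2) * sqnorm M (\<lambda>x. v r x - g x))))
      \<longlongrightarrow> 2 * 0 + 2 * (2 * (ennreal ((cmod a)\<^sup>2) * 0) + 2 * (ennreal ((cmod b)\<^sup>2) * 0))) F"
    by (intro tendsto_add tendsto_mult_ennreal tendsto_const lim) auto
  moreover have "\<forall>\<^sub>F r in F. sqnorm M k \<le> 2 * sqnorm M (\<lambda>x. (a * u r x + b * v r x) - h x) +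
      2 * (2 * (ennreal ((cmod a)\<^sup>2) * sqnorm M (\<lambda>x. u r x - f x)) + 2 * (ennreal ((cmod b)\<^sup>2) * sqnorm M (\<lambda>x. v r x - g x)))"
    using meas(1,2)
  proof eventually_elim
    case (elim r)
    note [measurable] = elim
    \<comment> \<open>Both splittings use \<open>\<delta> = 1\<close>: every summand on the right
      tends to 0, so fixed factors are harmless.\<close>
    have "sqnorm M (\<lambda>x. (h x - (a * u r x + b * v r x)) + (a * (u r x - f x) + b * (v r x - g x)))
      \<le> ennreal (1 + 1) * sqnorm M (\<lambda>x. h x - (a * u r x + b * v r x))
        + ennreal (1 + 1 / 1) * sqnorm M (\<lambda>x. a * (u r x - f x) + b * (v r x - g x))"
      by (intro sqnorm_add_le) auto
    also have "sqnorm M (\<lambda>x. a * (u r x - f x) + b * (v r x - g x))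
      \<le> ennreal (1 + 1) * sqnorm M (\<lambda>x. a * (u r x - f x)) + ennreal (1 + 1 / 1) * sqnorm M (\<lambda>x. b * (v r x - g x))"
      by (intro sqnorm_add_le) auto
    also have "sqnorm M (\<lambda>x. a * (u r x - f x)) = ennreal ((cmod a)\<^sup>2) * sqnorm M (\<lambda>x. u r x - f x)"
      by (rule sqnorm_cmult) measurable
    also have "sqnorm M (\<lambda>x. b * (v r x - g x)) = ennreal ((cmod b)\<^sup>2) * sqnorm M (\<lambda>x. v r x - g x)"
      by (rule sqnorm_cmult) measurable
    also have "sqnorm M (\<lambda>x. h x - (a * u r x + b * v r x)) = sqnorm M (\<lambda>x. (a * u r x + b * v r x) - h x)"
      by (rule sqnorm_minus_commute)
    also have "(\<lambda>x. (h x - (a * u r x + b * v r x)) + (a * (u r x - f x) + b * (v r x - g x))) = k"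
      by (simp add: k_def fun_eq_iff algebra_simps)
    finally show ?case by (simp add: mult_left_mono)
  qed
  ultimately have "sqnorm M k \<le> 2 * 0 + 2 * (2 * (ennreal ((cmod a)\<^sup>2) * 0) + 2 * (ennreal ((cmod b)\<^sup>2) * 0))"
    using F by (rule tendsto_lowerbound)
  then have "sqnorm M k = 0" by simp
  then have "AE x in M. k x = 0"
    by (subst (asm) nn_integral_0_iff_AE) auto
  then show ?thesis by eventually_elim (simp add: k_def algebra_simps)
qed

section \<open>Holomorphic and polynomial functions of several variables\<close>

lemma has_derivative_imp_holomorphic_vec:
  assumes "\<And>z. z \<in> X \<Longrightarrow> (f has_derivative D z) (at z)" "\<And>z c v. z \<in> X \<Longrightarrow> D z (c *s v) = c * D z v"
  shows "holomorphic_vec f X"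
  using assms unfolding holomorphic_vec_def by blast

lemma holomorphic_vec_const: "holomorphic_vec (\<lambda>z. c) X"
  by (rule has_derivative_imp_holomorphic_vec[where D = "\<lambda>z v. 0"]) auto

lemma holomorphic_vec_nth: "holomorphic_vec (\<lambda>z. z $ i) X"
  by (rule has_derivative_imp_holomorphic_vec[where D = "\<lambda>z v. v $ i"])
     (auto intro!: bounded_linear_imp_has_derivative bounded_linear_vec_nth)

lemma holomorphic_vec_add:
  assumes "holomorphic_vec f X" "holomorphic_vec g X"
  shows "holomorphic_vec (\<lambda>z. f z + g z) X"
  unfolding holomorphic_vec_def
proof
  fix z assume "z \<in> X"
  with assms obtain D E where "(f has_derivative D) (at z)" "(g has_derivative E) (at z)"
    and lin: "\<And>c v. D (c *s v) = c * D v" "\<And>c v. E (c *s v) = c * E v"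
    unfolding holomorphic_vec_def by metis
  then have "((\<lambda>z. f z + g z) has_derivative (\<lambda>v. D v + E v)) (at z)"
    by (intro derivative_intros)
  then show "\<exists>D. ((\<lambda>z. f z + g z) has_derivative D) (at z) \<and> (\<forall>c v. D (c *s v) = c * D v)"
    using lin by (intro exI[of _ "\<lambda>v. D v + E v"]) (simp add: distrib_left)
qed

lemma holomorphic_vec_mult:
  assumes "holomorphic_vec f X" "holomorphic_vec g X"
  shows "holomorphic_vec (\<lambda>z. f z * g z) X"
  unfolding holomorphic_vec_def
proof
  fix z assume "z \<in> X"
  with assms obtain D E where "(f has_derivative D) (at z)" "(g has_derivative E) (at z)"
    and lin: "\<And>c v. D (c *s v) = c * D v" "\<And>c v. E (c *s v) = c * E v"
    unfolding holomorphic_vec_def by metis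
  then have "((\<lambda>z. f z * g z) has_derivative (\<lambda>v. f z * E v + D v * g z)) (at z)"
    by (intro has_derivative_mult)
  then show "\<exists>D. ((\<lambda>z. f z * g z) has_derivative D) (at z) \<and> (\<forall>c v. D (c *s v) = c * D v)"
    using lin by (intro exI[of _ "\<lambda>v. f z * E v + D v * g z"]) (simp add: algebra_simps)
qed

lemma holomorphic_vec_sum:
  "(\<And>i. i \<in> I \<Longrightarrow> holomorphic_vec (f i) X) \<Longrightarrow> holomorphic_vec (\<lambda>z. \<Sum>i\<in>I. f i z) X"
  by (induction I rule: infinite_finite_induct) (auto intro: holomorphic_vec_const holomorphic_vec_add)

lemma holomorphic_vec_prod:
  "(\<And>i. i \<in> I \<Longrightarrow> holomorphic_vec (f i) X) \<Longrightarrow> holomorphic_vec (\<lambda>z. \<Prod>i\<in>I. f i z) X"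
  by (induction I rule: infinite_finite_induct) (auto intro: holomorphic_vec_const holomorphic_vec_mult)

lemma holomorphic_vec_power: "holomorphic_vec f X \<Longrightarrow> holomorphic_vec (\<lambda>z. f z ^ k) X"
  by (induction k) (auto intro: holomorphic_vec_const holomorphic_vec_mult)

lemma holomorphic_vec_subset: "holomorphic_vec f Y \<Longrightarrow> X \<subseteq> Y \<Longrightarrow> holomorphic_vec f X"
  unfolding holomorphic_vec_def by blast

lemma holomorphic_vec_imp_continuous_on: "holomorphic_vec f X \<Longrightarrow> continuous_on X f"
  unfolding holomorphic_vec_def
  by (intro continuous_at_imp_continuous_on) (blast intro: has_derivative_continuous)

lemma holomorphic_vec_compose:
  fixes \<theta> :: "complex^'n \<Rightarrow> complex^'n"
  assumes f: "holomorphic_vec f (\<theta> ` X)" and \<theta>: "\<And>i. holomorphic_vec (\<lambda>z. \<theta> z $ i) X"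
  shows "holomorphic_vec (\<lambda>z. f (\<theta> z)) X"
  unfolding holomorphic_vec_def
proof
  fix z assume z: "z \<in> X"
  have "\<forall>i. \<exists>D. ((\<lambda>z. \<theta> z $ i) has_derivative D) (at z) \<and> (\<forall>c v. D (c *s v) = c * D v)"
    using \<theta> z unfolding holomorphic_vec_def by blast
  then obtain E where E: "\<And>i. ((\<lambda>z. \<theta> z $ i) has_derivative E i) (at z)"
    and E_lin: "\<And>i c v. E i (c *s v) = c * E i v"
    by metis
  have "((\<lambda>z. \<chi> i. \<theta> z $ i) has_derivative (\<lambda>v. \<chi> i. E i v)) (at z)"
    using E by (subst has_derivative_componentwise_within)
      (auto simp: Basis_vec_def inner_axis intro!: has_derivative_inner_left)
  then have der: "(\<theta> has_derivative (\<lambda>v. \<chi> i. E i v)) (at z)" by simp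
  obtain D where D: "(f has_derivative D) (at (\<theta> z))" and D_lin: "\<And>c v. D (c *s v) = c * D v"
    using f z unfolding holomorphic_vec_def by blast
  have "(\<chi> i. E i (c *s v)) = c *s (\<chi> i. E i v)" for c v
    by (simp add: vec_eq_iff E_lin)
  with has_derivative_compose[OF der D] D_lin
  show "\<exists>D. ((\<lambda>z. f (\<theta> z)) has_derivative D) (at z) \<and> (\<forall>c v. D (c *s v) = c * D v)"
    by (intro exI[of _ "\<lambda>v. D (\<chi> i. E i v)"]) simp
qed

section \<open>Polynomial functions, homogeneity, and closure under ring operations\<close>

lemma polynomial_fun_imp_holomorphic_vec: "polynomial_fun p \<Longrightarrow> holomorphic_vec p X"
  unfolding polynomial_fun_def
  by (auto intro!: holomorphic_vec_sum holomorphic_vec_mult holomorphic_vec_const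
      holomorphic_vec_prod holomorphic_vec_power holomorphic_vec_nth)

lemma polynomial_fun_imp_continuous_on: "polynomial_fun p \<Longrightarrow> continuous_on X p"
  by (intro holomorphic_vec_imp_continuous_on polynomial_fun_imp_holomorphic_vec)

lemma homogeneous_fun_imp_polynomial_fun: "homogeneous_fun k p \<Longrightarrow> polynomial_fun p"
  unfolding homogeneous_fun_def polynomial_fun_def by blast

lemma homogeneous_fun_scaleR:
  assumes "homogeneous_fun k p"
  shows "p (r *\<^sub>R z) = of_real r ^ k * p z"
proof -
  obtain A c where A: "\<And>\<alpha>. \<alpha> \<in> A \<Longrightarrow> (\<Sum>i\<in>UNIV. \<alpha> i) = k"
    and p: "p = (\<lambda>z. \<Sum>\<alpha>\<in>A. c \<alpha> * (\<Prod>i\<in>UNIV. (z $ i) ^ \<alpha> i))"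
    using assms unfolding homogeneous_fun_def by blast
  have "(\<Prod>i\<in>UNIV. ((r *\<^sub>R z) $ i) ^ \<alpha> i) = of_real r ^ k * (\<Prod>i\<in>UNIV. (z $ i) ^ \<alpha> i)" if "\<alpha> \<in> A" for \<alpha>
  proof -
    have "(of_real r :: complex) ^ k = (\<Prod>i\<in>UNIV. of_real r ^ \<alpha> i)"
      unfolding A[OF that, symmetric] by (rule power_sum)
    then show ?thesis
      by (simp only: vector_scaleR_component) (simp add: scaleR_conv_of_real power_mult_distrib prod.distrib)
  qed
  then have "p (r *\<^sub>R z) = (\<Sum>\<alpha>\<in>A. c \<alpha> * (of_real r ^ k * (\<Prod>i\<in>UNIV. (z $ i) ^ \<alpha> i)))"
    unfolding p by (intro sum.cong) simp_all
  also have "\<dots> = of_real r ^ k * p z"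
    unfolding p sum_distrib_left by (intro sum.cong) simp_all
  finally show ?thesis .
qed

text \<open>The index type is arbitrary and exponents may repeat, which makes sums and products immediate.\<close>

lemma polynomial_funI:
  fixes \<alpha> :: "'i \<Rightarrow> 'n::finite \<Rightarrow> nat"
  assumes "finite I" "\<And>z. p z = (\<Sum>i\<in>I. c i * (\<Prod>j\<in>UNIV. (z $ j) ^ \<alpha> i j))"
  shows "polynomial_fun p"
proof -
  have "p z = (\<Sum>\<beta>\<in>\<alpha> ` I. (\<Sum>i\<in>{i \<in> I. \<alpha> i = \<beta>}. c i) * (\<Prod>j\<in>UNIV. (z $ j) ^ \<beta> j))" for z
  proof -
    have "p z = (\<Sum>\<beta>\<in>\<alpha> ` I. \<Sum>i\<in>{i \<in> I. \<alpha> i = \<beta>}. c i * (\<Prod>j\<in>UNIV. (z $ j) ^ \<alpha> i j))"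
      unfolding assms(2) by (rule sum.image_gen[OF assms(1)])
    also have "\<dots> = (\<Sum>\<beta>\<in>\<alpha> ` I. (\<Sum>i\<in>{i \<in> I. \<alpha> i = \<beta>}. c i) * (\<Prod>j\<in>UNIV. (z $ j) ^ \<beta> j))"
      by (intro sum.cong) (auto simp: sum_distrib_right)
    finally show ?thesis .
  qed
  then show ?thesis
    unfolding polynomial_fun_def using assms(1)
    by (intro exI[of _ "\<alpha> ` I"] exI[of _ "\<lambda>\<beta>. \<Sum>i\<in>{i \<in> I. \<alpha> i = \<beta>}. c i"]) auto
qed

lemma polynomial_fun_const: "polynomial_fun (\<lambda>z. c)"
  by (rule polynomial_funI[of "{()}" _ "\<lambda>_. c" "\<lambda>_ _. 0"]) auto

lemma polynomial_fun_nth: "polynomial_fun (\<lambda>z::complex^'n. z $ i)"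
proof (rule polynomial_funI[of "{()}" _ "\<lambda>_. 1" "\<lambda>_ j. if j = i then 1 else 0"])
  fix z :: "complex^'n"
  have "(\<Prod>j\<in>UNIV. z $ j ^ (if j = i then 1 else 0)) = (\<Prod>j\<in>UNIV. if j = i then z $ j else 1)"
    by (rule prod.cong) auto
  then show "z $ i = (\<Sum>u\<in>{()}. 1 * (\<Prod>j\<in>UNIV. z $ j ^ (if j = i then 1 else 0)))"
    by simp
qed simp

lemma polynomial_fun_add:
  assumes "polynomial_fun p" "polynomial_fun q"
  shows "polynomial_fun (\<lambda>z. p z + q z)"
proof -
  obtain A c where p: "finite A" "p = (\<lambda>z. \<Sum>\<alpha>\<in>A. c \<alpha> * (\<Prod>i\<in>UNIV. (z $ i) ^ \<alpha> i))"
    using assms(1) unfolding polynomial_fun_def by blast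
  obtain B d where q: "finite B" "q = (\<lambda>z. \<Sum>\<alpha>\<in>B. d \<alpha> * (\<Prod>i\<in>UNIV. (z $ i) ^ \<alpha> i))"
    using assms(2) unfolding polynomial_fun_def by blast
  show ?thesis
  proof (rule polynomial_funI[of "A <+> B" _ "case_sum c d" "case_sum id id"])
    show "p z + q z = (\<Sum>i\<in>A <+> B. case_sum c d i * (\<Prod>j\<in>UNIV. z $ j ^ case_sum id id i j))" for z
      unfolding p(2) q(2) sum.Plus[OF p(1) q(1)] by simp
  qed (use p q in simp)
qed

lemma polynomial_fun_mult:
  assumes "polynomial_fun p" "polynomial_fun q"
  shows "polynomial_fun (\<lambda>z. p z * q z)"
proof -
  obtain A c where p: "finite A" "p = (\<lambda>z. \<Sum>\<alpha>\<in>A. c \<alpha> * (\<Prod>i\<in>UNIV. (z $ i) ^ \<alpha> i))"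
    using assms(1) unfolding polynomial_fun_def by blast
  obtain B d where q: "finite B" "q = (\<lambda>z. \<Sum>\<alpha>\<in>B. d \<alpha> * (\<Prod>i\<in>UNIV. (z $ i) ^ \<alpha> i))"
    using assms(2) unfolding polynomial_fun_def by blast
  show ?thesis
  proof (rule polynomial_funI[of "A \<times> B" _ "\<lambda>x. c (fst x) * d (snd x)" "\<lambda>x i. fst x i + snd x i"])
    show "p z * q z = (\<Sum>x\<in>A \<times> B. c (fst x) * d (snd x) * (\<Prod>j\<in>UNIV. z $ j ^ (fst x j + snd x j)))" for z
      unfolding p(2) q(2) sum_product sum.cartesian_product
      by (intro sum.cong) (auto simp: power_add prod.distrib)
  qed (use p q in simp)
qed

lemma polynomial_fun_sum:
  "(\<And>i. i \<in> I \<Longrightarrow> polynomial_fun (p i)) \<Longrightarrow> polynomial_fun (\<lambda>z. \<Sum>i\<in>I. p i z)"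
  by (induction I rule: infinite_finite_induct) (auto intro: polynomial_fun_const polynomial_fun_add)

lemma polynomial_fun_prod:
  "(\<And>i. i \<in> I \<Longrightarrow> polynomial_fun (p i)) \<Longrightarrow> polynomial_fun (\<lambda>z. \<Prod>i\<in>I. p i z)"
  by (induction I rule: infinite_finite_induct) (auto intro: polynomial_fun_const polynomial_fun_mult)

lemma polynomial_fun_power: "polynomial_fun p \<Longrightarrow> polynomial_fun (\<lambda>z. p z ^ k)"
  by (induction k) (auto intro: polynomial_fun_const polynomial_fun_mult)

section \<open>Pseudoreflection groups and basic polynomial maps\<close>

lemma matrix_inv_mult:
  fixes A :: "'a::semiring_1^'n^'n"
  assumes "invertible A"
  shows "A ** matrix_inv A = mat 1" "matrix_inv A ** A = mat 1"
  using someI_ex[OF assms[unfolded invertible_def]] by (auto simp: matrix_inv_def)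

lemma group_GL: "group GL"
proof (rule groupI)
  fix A :: "complex^'n^'n" assume "A \<in> carrier GL"
  then show "\<exists>B\<in>carrier GL. B \<otimes>\<^bsub>GL\<^esub> A = \<one>\<^bsub>GL\<^esub>"
    using matrix_inv_mult[of A]
    by (intro bexI[of _ "matrix_inv A"]) (auto simp: GL_def invertible_def)
next
  have "invertible (mat 1 :: complex^'n^'n)" by (auto simp: invertible_def intro: exI[of _ "mat 1"])
  then show "\<one>\<^bsub>GL\<^esub> \<in> carrier (GL :: (complex^'n^'n) monoid)" by (simp add: GL_def)
qed (auto simp: GL_def invertible_mult matrix_mul_assoc)

lemma pseudoreflection_group_subgroup:
  fixes G :: "(complex^'n^'n) set"
  assumes "pseudoreflection_group G"
  shows "mat 1 \<in> G"
    and "\<And>A B. A \<in> G \<Longrightarrow> B \<in> G \<Longrightarrow> A ** B \<in> G"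
    and "\<And>A. A \<in> G \<Longrightarrow> invertible A"
    and "\<And>A. A \<in> G \<Longrightarrow> matrix_inv A \<in> G"
    and "\<And>A. A \<in> G \<Longrightarrow> \<exists>B\<in>G. A = matrix_inv B"
proof -
  interpret group "GL :: (complex^'n^'n) monoid" by (rule group_GL)
  obtain S where "\<forall>\<sigma>\<in>S. pseudoreflection \<sigma>" "G = generate GL S"
    using assms unfolding pseudoreflection_group_def by blast
  then have "subgroup G GL"
    by (auto intro!: generate_is_subgroup simp: pseudoreflection_def)
  then interpret subgroup G GL .
  show 1: "mat 1 \<in> G" using one_closed by (simp add: GL_def)
  show "A ** B \<in> G" if "A \<in> G" "B \<in> G" for A B using m_closed[OF that] by (simp add: GL_def)
  show inv: "invertible A" if "A \<in> G" for A using mem_carrier[OF that] by (simp add: GL_def)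
  have eq: "inv\<^bsub>GL\<^esub> A = matrix_inv A" if "A \<in> G" for A
    using matrix_inv_mult[OF inv[OF that]] inv[OF that]
    by (intro inv_equality) (auto simp: GL_def invertible_def)
  show "matrix_inv A \<in> G" if "A \<in> G" for A
    using m_inv_closed[OF that] by (simp add: eq[OF that])
  show "\<exists>B\<in>G. A = matrix_inv B" if "A \<in> G" for A
    using that by (intro bexI[of _ "inv\<^bsub>GL\<^esub> A"]) (simp_all flip: eq)
qed

lemma invariant_fun_iff:
  assumes "pseudoreflection_group G"
  shows "invariant_fun G p \<longleftrightarrow> (\<forall>\<sigma>\<in>G. \<forall>z. p (\<sigma> *v z) = p z)"
  using pseudoreflection_group_subgroup(4,5)[OF assms] unfolding invariant_fun_def by metis

text \<open>Right multiplication by \<open>\<tau>\<close> permutes the summands.\<close>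

lemma invariant_fun_group_sum:
  assumes G: "pseudoreflection_group G"
  shows "invariant_fun G (\<lambda>z. \<Sum>\<sigma>\<in>G. p (\<sigma> *v z))"
  unfolding invariant_fun_iff[OF G]
proof (intro ballI allI)
  fix \<tau> z assume \<tau>: "\<tau> \<in> G"
  note sub = pseudoreflection_group_subgroup[OF G]
  have "bij_betw (\<lambda>\<sigma>. \<sigma> ** \<tau>) G G"
    by (rule bij_betw_byWitness[where f' = "\<lambda>\<sigma>. \<sigma> ** matrix_inv \<tau>"])
       (use \<tau> sub matrix_inv_mult[OF sub(3)[OF \<tau>]] in \<open>auto simp flip: matrix_mul_assoc\<close>)
  then have "(\<Sum>\<sigma>\<in>G. p ((\<sigma> ** \<tau>) *v z)) = (\<Sum>\<sigma>\<in>G. p (\<sigma> *v z))"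
    by (rule sum.reindex_bij_betw)
  then show "(\<Sum>\<sigma>\<in>G. p (\<sigma> *v (\<tau> *v z))) = (\<Sum>\<sigma>\<in>G. p (\<sigma> *v z))"
    by (simp add: matrix_vector_mul_assoc)
qed

section \<open>Basic polynomial maps and generating polynomials\<close>

lemma basic_polynomial_map_polynomial_fun:
  "basic_polynomial_map G \<theta> \<Longrightarrow> polynomial_fun (\<lambda>z. \<theta> z $ i)"
  unfolding basic_polynomial_map_def using homogeneous_fun_imp_polynomial_fun by blast

lemma basic_polynomial_map_continuous_on:
  assumes "basic_polynomial_map G \<theta>"
  shows "continuous_on X \<theta>"
proof -
  have "continuous_on X (\<lambda>z. \<chi> i. \<theta> z $ i)"
    by (intro continuous_on_vec_lambda polynomial_fun_imp_continuous_on
        basic_polynomial_map_polynomial_fun[OF assms])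
  then show ?thesis by simp
qed

lemma basic_polynomial_map_factor:
  assumes "basic_polynomial_map G \<theta>" "polynomial_fun p" "invariant_fun G p"
  obtains q where "polynomial_fun q" "\<And>z. p z = q (\<theta> z)"
proof -
  have "p \<in> {q \<circ> \<theta> | q. polynomial_fun q}"
    using assms unfolding basic_polynomial_map_def by blast
  then show thesis using that by auto
qed

text \<open>Each component of \<open>\<theta>\<close> is the composition of a coordinate function
  with \<open>\<theta>\<close>, hence belongs to the invariant ring.\<close>

lemma basic_polynomial_map_invariant:
  assumes "basic_polynomial_map G \<theta>" "pseudoreflection_group G" "\<sigma> \<in> G"
  shows "\<theta> (\<sigma> *v z) = \<theta> z"
proof -
  have "(\<lambda>w. w $ i) \<circ> \<theta> \<in> {q \<circ> \<theta> | q. polynomial_fun q}" for i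
    using polynomial_fun_nth by blast
  then have "invariant_fun G ((\<lambda>w. w $ i) \<circ> \<theta>)" for i
    using assms(1) unfolding basic_polynomial_map_def by blast
  then show ?thesis
    using assms(2,3) by (simp add: invariant_fun_iff vec_eq_iff)
qed

lemma generating_polynomial_holomorphic_vec:
  assumes "generating_polynomial G \<rho> \<ll>"
  shows "holomorphic_vec \<ll> X"
proof -
  obtain a L where L: "\<And>H. H \<in> reflecting_hyperplanes G \<Longrightarrow> homogeneous_fun 1 (L H)"
    and l: "\<ll> = (\<lambda>z. \<Prod>H\<in>reflecting_hyperplanes G. L H z ^ (LEAST c. \<rho> (a H) = det (a H) ^ c))"
    using assms unfolding generating_polynomial_def by blast
  show ?thesis
    unfolding l by (intro holomorphic_vec_prod holomorphic_vec_power
        polynomial_fun_imp_holomorphic_vec homogeneous_fun_imp_polynomial_fun[OF L])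
qed

lemma generating_polynomial_scaleR:
  assumes "generating_polynomial G \<rho> \<ll>"
  obtains d where "\<And>r z. \<ll> (r *\<^sub>R z) = of_real r ^ d * \<ll> z"
proof -
  obtain a L where L: "\<And>H. H \<in> reflecting_hyperplanes G \<Longrightarrow> homogeneous_fun 1 (L H)"
    and l: "\<ll> = (\<lambda>z. \<Prod>H\<in>reflecting_hyperplanes G. L H z ^ (LEAST c. \<rho> (a H) = det (a H) ^ c))"
    using assms unfolding generating_polynomial_def by blast
  have "\<ll> (r *\<^sub>R z) = of_real r ^ (\<Sum>H\<in>reflecting_hyperplanes G. LEAST c. \<rho> (a H) = det (a H) ^ c) * \<ll> z" for r z
    unfolding l
    by (simp add: homogeneous_fun_scaleR[OF L] power_mult_distrib prod.distrib power_sum cong: prod.cong)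
  then show thesis by (rule that)
qed

section \<open>The image of the boundary\<close>

lemma norm_sum_mult_cnj_le:
  fixes z w :: "complex^'n"
  shows "cmod (\<Sum>i\<in>UNIV. z $ i * cnj (w $ i)) \<le> norm z * norm w"
proof -
  have "cmod (\<Sum>i\<in>UNIV. z $ i * cnj (w $ i)) \<le> (\<Sum>i\<in>UNIV. \<bar>cmod (z $ i)\<bar> * \<bar>cmod (w $ i)\<bar>)"
    by (rule order_trans[OF norm_sum]) (simp add: norm_mult)
  also have "\<dots> \<le> norm z * norm w"
    unfolding norm_vec_def by (rule L2_set_mult_ineq)
  finally show ?thesis .
qed

lemma Re_sum_mult_cnj:
  fixes z w :: "complex^'n"
  shows "Re (\<Sum>i\<in>UNIV. z $ i * cnj (w $ i)) = inner z w"
  by (simp add: inner_vec_def inner_complex_def)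

text \<open>The polynomial is \<open>(1 + w) / 2\<close>, where \<open>w\<close> is the Hermitian
  product with \<open>\<zeta>\<close> divided by \<open>R\<^sup>2\<close>. By Cauchy-Schwarz
  \<open>w\<close> is bounded by 1, but it has modulus 1 on the whole circle through
  \<open>\<zeta>\<close>; averaging with 1 leaves only the point where \<open>w = 1\<close>, which
  is \<open>\<zeta>\<close>.\<close>

lemma polynomial_peak_on_cball:
  fixes \<zeta> :: "complex^'n"
  assumes R: "0 < R" and \<zeta>: "norm \<zeta> = R"
  obtains h where "polynomial_fun h" "h \<zeta> = 1" "\<And>z. norm z \<le> R \<Longrightarrow> z \<noteq> \<zeta> \<Longrightarrow> cmod (h z) < 1"
proof -
  define w where "w z = (\<Sum>i\<in>UNIV. z $ i * cnj (\<zeta> $ i)) / of_real (R\<^sup>2)" for z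
  have "polynomial_fun (\<lambda>z. (1/2) * (1 + (\<Sum>i\<in>UNIV. z $ i * cnj (\<zeta> $ i)) * (1 / of_real (R\<^sup>2))))"
    by (intro polynomial_fun_add polynomial_fun_mult polynomial_fun_const polynomial_fun_sum polynomial_fun_nth)
  then have poly: "polynomial_fun (\<lambda>z. (1 + w z) / 2)" by (simp add: w_def)
  have Re: "Re (w z) = inner z \<zeta> / R\<^sup>2" for z
    unfolding w_def Re_divide_of_real Re_sum_mult_cnj ..
  have "(\<Sum>i\<in>UNIV. \<zeta> $ i * cnj (\<zeta> $ i)) = of_real (R\<^sup>2)"
  proof -
    have "(\<Sum>i\<in>UNIV. \<zeta> $ i * cnj (\<zeta> $ i)) = of_real (\<Sum>i\<in>UNIV. (cmod (\<zeta> $ i))\<^sup>2)"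
      by (simp flip: complex_norm_square)
    then show ?thesis using \<zeta> by (simp add: norm_vec_def L2_set_def sum_nonneg flip: \<zeta>)
  qed
  then have one: "(1 + w \<zeta>) / 2 = 1" using R by (simp add: w_def)
  have less: "cmod ((1 + w z) / 2) < 1" if z: "norm z \<le> R" "z \<noteq> \<zeta>" for z
  proof -
    have "cmod (w z) = cmod (\<Sum>i\<in>UNIV. z $ i * cnj (\<zeta> $ i)) / R\<^sup>2"
      by (simp add: w_def norm_divide norm_power)
    also have "\<dots> \<le> (R * R) / R\<^sup>2"
      using order_trans[OF norm_sum_mult_cnj_le[of z \<zeta>] mult_mono[OF z(1) eq_refl[OF \<zeta>]]] R
      by (intro divide_right_mono) auto
    finally have w: "cmod (w z) \<le> 1" using R by (simp add: power2_eq_square)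
    \<comment> \<open>Expanding the squared distance from \<open>z\<close> to \<open>\<zeta>\<close>
      turns \<open>z \<noteq> \<zeta>\<close> into the strict inequality
      \<open>Re (w z) < 1\<close>.\<close>
    have "0 < inner (z - \<zeta>) (z - \<zeta>)" using z by simp
    also have "\<dots> = (norm z)\<^sup>2 + R\<^sup>2 - 2 * inner z \<zeta>"
      using \<zeta> by (simp add: inner_diff_left inner_diff_right inner_commute power2_norm_eq_inner flip: \<zeta>)
    also have "\<dots> \<le> 2 * R\<^sup>2 - 2 * inner z \<zeta>"
      using power_mono[OF z(1), of 2] by simp
    finally have "Re (w z) < 1" using R by (simp add: Re)
    have "(cmod (1 + w z))\<^sup>2 = 1 + 2 * Re (w z) + (cmod (w z))\<^sup>2"
      unfolding cmod_power2 by (simp add: power2_eq_square algebra_simps)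
    also have "\<dots> < 2\<^sup>2"
      using \<open>Re (w z) < 1\<close> power_le_one[OF norm_ge_zero w, of 2] by simp
    finally have "cmod (1 + w z) < 2" by (rule power_less_imp_less_base) simp
    then show ?thesis by (simp add: norm_divide)
  qed
  show thesis by (rule that[OF poly one less])
qed

lemma shilov_boundary_subset_closure: "shilov_boundary X \<subseteq> closure X"
proof -
  have "boundary_for X (closure X)" unfolding boundary_for_def by auto
  then show ?thesis unfolding shilov_boundary_def by blast
qed

lemma closure_image_subset:
  fixes \<theta> :: "'a::heine_borel \<Rightarrow> 'b::t2_space"
  assumes "bounded X" "continuous_on (closure X) \<theta>"
  shows "closure (\<theta> ` X) \<subseteq> \<theta> ` closure X"
proof (rule closure_minimal)
  show "closed (\<theta> ` closure X)"
    by (rule compact_imp_closed, rule compact_continuous_image)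
       (use assms in \<open>auto simp: compact_eq_bounded_closed\<close>)
qed (use closure_subset in blast)

text \<open>If a boundary \<open>K\<close> missed \<open>\<theta> \<zeta>\<close>, summing the \<open>N\<close>-th power of a polynomial peaking at \<open>\<zeta>\<close> over \<open>G\<close>
  would give, for large \<open>N\<close>, a polynomial in \<open>\<theta>\<close> that is larger at \<open>\<theta> \<zeta>\<close> than on \<open>K\<close>.\<close>

lemma basic_polynomial_map_in_shilov_boundary:
  fixes \<theta> :: "complex^'n \<Rightarrow> complex^'n"
  assumes fin: "finite G" and G: "pseudoreflection_group G" and \<theta>: "basic_polynomial_map G \<theta>"
    and G\<Omega>: "\<forall>\<sigma>\<in>G. (\<lambda>z. \<sigma> *v z) ` \<Omega> = \<Omega>"
    and R: "0 < R" and \<Omega>: "\<Omega> \<subseteq> cball 0 R" and \<zeta>: "\<zeta> \<in> closure \<Omega>" "norm \<zeta> = R"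
  shows "\<theta> \<zeta> \<in> shilov_boundary (\<theta> ` \<Omega>)"
  unfolding shilov_boundary_def
proof (rule InterI, rule ccontr, unfold mem_Collect_eq)
  fix K assume K: "boundary_for (\<theta> ` \<Omega>) K" and notin: "\<theta> \<zeta> \<notin> K"
  note sub = pseudoreflection_group_subgroup[OF G]
  note inv = basic_polynomial_map_invariant[OF \<theta> G]
  obtain h where h: "polynomial_fun h" and h\<zeta>: "h \<zeta> = 1"
    and h_less: "\<And>z. norm z \<le> R \<Longrightarrow> z \<noteq> \<zeta> \<Longrightarrow> cmod (h z) < 1"
    by (rule polynomial_peak_on_cball[OF R \<zeta>(2)]) blast
  have cl: "closure \<Omega> \<subseteq> cball 0 R" using \<Omega> by (intro closure_minimal) auto
  have bd: "bounded \<Omega>" using \<Omega> bounded_cball bounded_subset by blast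
  have cont: "continuous_on X \<theta>" for X by (rule basic_polynomial_map_continuous_on[OF \<theta>])
  have G_cl: "\<sigma> *v z \<in> closure \<Omega>" if "\<sigma> \<in> G" "z \<in> closure \<Omega>" for \<sigma> z
  proof -
    have "(\<lambda>z. \<sigma> *v z) ` closure \<Omega> \<subseteq> closure ((\<lambda>z. \<sigma> *v z) ` \<Omega>)"
      by (rule image_closure_subset) (auto intro!: closure_subset continuous_intros matrix_vector_mult_linear_continuous_on)
    then show ?thesis using that G\<Omega> by auto
  qed
  \<comment> \<open>The part of the closure lying over \<open>K\<close>. It is stable under
    \<open>G\<close>, because \<open>\<theta>\<close> is invariant, and it does not contain
    \<open>\<zeta>\<close>.\<close>
  define Z where "Z = {z \<in> closure \<Omega>. \<theta> z \<in> K}"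
  have "compact Z"
  proof -
    have "closed (closure \<Omega> \<inter> \<theta> -` K)"
      using K by (intro continuous_closed_preimage cont) (auto simp: boundary_for_def)
    moreover have "Z = closure \<Omega> \<inter> \<theta> -` K" by (auto simp: Z_def)
    moreover have "bounded Z" using bd by (auto simp: Z_def intro: bounded_subset[of "closure \<Omega>"])
    ultimately show ?thesis by (simp add: compact_eq_bounded_closed)
  qed
  \<comment> \<open>By compactness the peak polynomial stays uniformly below 1 in modulus on
    \<open>Z\<close>; if \<open>Z\<close> is empty, \<open>c = 0\<close> serves.\<close>
  obtain c where c: "0 \<le> c" "c < 1" "\<And>z. z \<in> Z \<Longrightarrow> cmod (h z) \<le> c"
  proof (cases "Z = {}")
    case True
    then show thesis using that[of 0] by simp
  next
    case False
    have "continuous_on Z (\<lambda>z. cmod (h z))"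
      by (intro continuous_intros polynomial_fun_imp_continuous_on h)
    from continuous_attains_sup[OF \<open>compact Z\<close> False this] obtain x
      where x: "x \<in> Z" "\<And>z. z \<in> Z \<Longrightarrow> cmod (h z) \<le> cmod (h x)" by blast
    have "x \<noteq> \<zeta>" using x(1) notin by (auto simp: Z_def)
    moreover have "norm x \<le> R" using x(1) cl by (auto simp: Z_def)
    ultimately show thesis using that[of "cmod (h x)"] x h_less by auto
  qed
  define P where "P N z = (\<Sum>\<sigma>\<in>G. h (\<sigma> *v z) ^ N)" for N z
  have bound: "cmod (P N z) \<le> card G * c ^ N" if "z \<in> Z" for N z
  proof -
    have "cmod (h (\<sigma> *v z) ^ N) \<le> c ^ N" if "\<sigma> \<in> G" for \<sigma>
      unfolding norm_power
      using that \<open>z \<in> Z\<close> G_cl by (intro power_mono c(3)) (auto simp: Z_def inv)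
    then show ?thesis unfolding P_def by (rule sum_norm_bound)
  qed
  \<comment> \<open>Group elements fixing \<open>\<zeta>\<close> contribute exactly 1, and all
    others a power of a number of modulus less than 1. Hence no cancellation can occur in the
    limit.\<close>
  have lim: "(\<lambda>N. P N \<zeta>) \<longlonglongrightarrow> of_nat (card {\<sigma> \<in> G. \<sigma> *v \<zeta> = \<zeta>})"
  proof -
    have "(\<lambda>N. P N \<zeta>) \<longlonglongrightarrow> (\<Sum>\<sigma>\<in>G. if \<sigma> *v \<zeta> = \<zeta> then 1 else 0)"
      unfolding P_def
    proof (rule tendsto_sum)
      fix \<sigma> assume \<sigma>: "\<sigma> \<in> G"
      show "(\<lambda>N. h (\<sigma> *v \<zeta>) ^ N) \<longlonglongrightarrow> (if \<sigma> *v \<zeta> = \<zeta> then 1 else 0)"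
      proof (cases "\<sigma> *v \<zeta> = \<zeta>")
        case False
        then have "cmod (h (\<sigma> *v \<zeta>)) < 1" using G_cl[OF \<sigma> \<zeta>(1)] cl by (intro h_less) auto
        with False show ?thesis by (simp add: LIMSEQ_power_zero)
      qed (simp add: h\<zeta>)
    qed
    then show ?thesis using fin by (simp add: sum.If_cases Int_def)
  qed
  \<comment> \<open>Thanks to the identity matrix the limit at \<open>\<zeta>\<close> is at least 1,
    whereas the bound on \<open>Z\<close> tends to 0; the value \<open>1/2\<close> separates the
    two.\<close>
  have "mat 1 \<in> {\<sigma> \<in> G. \<sigma> *v \<zeta> = \<zeta>}" using sub(1) by simp
  then have card: "1 \<le> card {\<sigma> \<in> G. \<sigma> *v \<zeta> = \<zeta>}" using fin by (auto simp: Suc_le_eq card_gt_0_iff)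
  have "\<forall>\<^sub>F N in sequentially. 1/2 < cmod (P N \<zeta>)"
    using tendsto_norm[OF lim] card by (intro order_tendstoD(1)) auto
  moreover have "(\<lambda>N. card G * c ^ N) \<longlonglongrightarrow> real (card G) * 0"
    using c by (intro tendsto_intros LIMSEQ_power_zero) auto
  then have "\<forall>\<^sub>F N in sequentially. card G * c ^ N < 1/2"
    by (intro order_tendstoD(2)) auto
  ultimately obtain N where N: "1/2 < cmod (P N \<zeta>)" "card G * c ^ N < 1/2"
    using eventually_happens'[OF sequentially_bot eventually_conj] by blast
  have "polynomial_fun (\<lambda>z. h (\<sigma> *v z))" for \<sigma>
  proof -
    obtain A d where "finite A" "h = (\<lambda>z. \<Sum>\<alpha>\<in>A. d \<alpha> * (\<Prod>i\<in>UNIV. (z $ i) ^ \<alpha> i))"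
      using h unfolding polynomial_fun_def by blast
    moreover have "polynomial_fun (\<lambda>z. (\<sigma> *v z) $ i)" for i
      unfolding matrix_vector_mult_def vec_lambda_beta
      by (intro polynomial_fun_sum polynomial_fun_mult polynomial_fun_const polynomial_fun_nth)
    ultimately show ?thesis
      by (auto intro!: polynomial_fun_sum polynomial_fun_mult polynomial_fun_const polynomial_fun_prod polynomial_fun_power)
  qed
  then have "polynomial_fun (P N)"
    unfolding P_def by (intro polynomial_fun_sum polynomial_fun_power)
  moreover have "invariant_fun G (P N)"
    unfolding P_def by (rule invariant_fun_group_sum[OF G])
  ultimately obtain q where q: "polynomial_fun q" and Pq: "\<And>z. P N z = q (\<theta> z)"
    by (rule basic_polynomial_map_factor[OF \<theta>]) auto
  have "\<theta> \<zeta> \<in> closure (\<theta> ` \<Omega>)"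
    using image_closure_subset[OF cont closed_closure closure_subset] \<zeta>(1) by blast
  with K q obtain w where w: "w \<in> K" "cmod (q (\<theta> \<zeta>)) \<le> cmod (q w)"
    unfolding boundary_for_def
    by (meson polynomial_fun_imp_continuous_on polynomial_fun_imp_holomorphic_vec)
  \<comment> \<open>A boundary lies in the closure of the image, so \<open>w\<close> lifts to a
    point of \<open>Z\<close>, where the uniform bound on \<open>P N\<close> applies.\<close>
  have "w \<in> closure (\<theta> ` \<Omega>)" using K w(1) by (auto simp: boundary_for_def)
  then obtain z where z: "z \<in> closure \<Omega>" "w = \<theta> z"
    using closure_image_subset[OF bd cont] by blast
  with w have "z \<in> Z" "cmod (P N \<zeta>) \<le> cmod (P N z)" by (auto simp: Z_def Pq)
  with bound[of z N] N show False by linarith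
qed

section \<open>Circular domains\<close>

lemma norm_vector_scalar_mult:
  fixes z :: "complex^'n"
  shows "norm (c *s z) = cmod c * norm z"
  by (simp add: norm_vec_def norm_mult L2_set_right_distrib)

lemma scaleR_eq_vector_scalar_mult:
  fixes z :: "complex^'n"
  shows "r *\<^sub>R z = of_real r *s z"
  unfolding vec_eq_iff vector_scaleR_component vector_smult_component by (simp add: scaleR_conv_of_real)

lemma continuous_on_vector_scalar_mult:
  fixes f :: "'a::topological_space \<Rightarrow> complex" and g :: "'a \<Rightarrow> complex^'n"
  assumes "continuous_on X f" "continuous_on X g"
  shows "continuous_on X (\<lambda>x. f x *s g x)"
  unfolding vector_scalar_mult_def
  by (intro continuous_on_vec_lambda continuous_intros assms continuous_on_component)

text \<open>The common ground of ball and polydisc, with \<open>S\<close> the sphere or the torus.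
  \<open>R\<close> is the norm at which points of \<open>S\<close> are peak points. Angles in
  \<open>[0, 2 * pi]\<close> are those over which circle means are taken. The closure appears in
  \<open>dilate\<close> because points of the Shilov boundary of the image lift only to the
  closure.\<close>

locale circular_domain = finite_measure m
  for m :: "(complex^'n) measure" +
  fixes \<Omega> S :: "(complex^'n) set" and R :: real
  assumes sets_m: "sets m = sets (restrict_space borel S)"
    and rotate_S: "\<zeta> \<in> S \<Longrightarrow> cis t *s \<zeta> \<in> S"
    and rotate_m: "t \<in> {0..2 * pi} \<Longrightarrow> distr m m (\<lambda>\<zeta>. cis t *s \<zeta>) = m"
    and R_pos: "0 < R" and norm_S: "\<zeta> \<in> S \<Longrightarrow> norm \<zeta> = R"
    and \<Omega>_subset: "\<Omega> \<subseteq> cball 0 R" and S_subset: "S \<subseteq> closure \<Omega>"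
    and dilate: "z \<in> closure \<Omega> \<Longrightarrow> 0 \<le> r \<Longrightarrow> r < 1 \<Longrightarrow> r *\<^sub>R z \<in> \<Omega>"
begin

lemma space_m: "space m = S"
  using sets_eq_imp_space_eq[OF sets_m] by (simp add: space_restrict_space)

lemma borel_measurable_m_iff: "f \<in> borel_measurable m \<longleftrightarrow> f \<in> borel_measurable (restrict_space borel S)"
  using measurable_cong_sets[OF sets_m refl] by blast

lemma measurable_ident_m [measurable]: "(\<lambda>x. x) \<in> measurable m borel"
proof -
  have "(\<lambda>x. x) \<in> measurable (restrict_space borel S) borel"
    by (rule measurable_restrict_space1) simp
  then show ?thesis using measurable_cong_sets[OF sets_m refl] by blast
qed

lemma rotate_joint_measurable:
  "(\<lambda>p. cis (fst p) *s snd p) \<in> measurable (lborel \<Otimes>\<^sub>M m) m"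
proof -
  have [measurable]: "(\<lambda>p. snd p) \<in> measurable (lborel \<Otimes>\<^sub>M m) borel"
    using measurable_compose[OF measurable_snd measurable_ident_m] .
  have "(\<lambda>p. cis (fst p) *s snd p) \<in> measurable (lborel \<Otimes>\<^sub>M m) borel"
  proof (rule borel_measurable_continuous_Pair[where H = "\<lambda>t z. cis t *s z"])
    show "continuous_on UNIV (\<lambda>x::real \<times> (complex^'n). cis (fst x) *s snd x)"
      by (intro continuous_on_vector_scalar_mult continuous_on_cis continuous_intros)
  qed measurable
  moreover have "(\<lambda>p. cis (fst p) *s snd p) \<in> space (lborel \<Otimes>\<^sub>M m) \<rightarrow> S"
    by (auto simp: space_pair_measure space_m rotate_S)
  ultimately have "(\<lambda>p. cis (fst p) *s snd p) \<in> measurable (lborel \<Otimes>\<^sub>M m) (restrict_space borel S)"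
    by (intro measurable_restrict_space2)
  then show ?thesis using measurable_cong_sets[OF refl sets_m] by blast
qed

lemma rotate_measurable: "(\<lambda>\<zeta>. cis t *s \<zeta>) \<in> measurable m m"
  using measurable_compose_Pair1[OF _ rotate_joint_measurable, of t] by simp

text \<open>After exchanging the integrals, rotation invariance makes the inner integral independent
  of the angle. Measurability of the circle mean is recorded because sums of such means are
  integrated over \<open>S\<close> later.\<close>

lemma circle_average:
  assumes h: "h \<in> borel_measurable m"
  shows "(\<integral>\<^sup>+\<zeta>. (\<integral>\<^sup>+t. h (cis t *s \<zeta>) * indicator {0..2 * pi} t \<partial>lborel) \<partial>m) = ennreal (2 * pi) * (\<integral>\<^sup>+\<zeta>. h \<zeta> \<partial>m)"
    and "(\<lambda>\<zeta>. \<integral>\<^sup>+t. h (cis t *s \<zeta>) * indicator {0..2 * pi} t \<partial>lborel) \<in> borel_measurable m"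
proof -
  interpret pair_sigma_finite lborel m
    by (intro pair_sigma_finite.intro sigma_finite_lborel sigma_finite_measure_axioms)
  have [measurable]: "(\<lambda>p. h (cis (fst p) *s snd p)) \<in> borel_measurable (lborel \<Otimes>\<^sub>M m)"
    by (rule measurable_compose[OF rotate_joint_measurable h])
  have meas: "(\<lambda>(t, \<zeta>). h (cis t *s \<zeta>) * indicator {0..2 * pi} t) \<in> borel_measurable (lborel \<Otimes>\<^sub>M m)"
    unfolding case_prod_beta by measurable
  have "(\<integral>\<^sup>+\<zeta>. (\<integral>\<^sup>+t. h (cis t *s \<zeta>) * indicator {0..2 * pi} t \<partial>lborel) \<partial>m)
      = (\<integral>\<^sup>+t. (\<integral>\<^sup>+\<zeta>. h (cis t *s \<zeta>) * indicator {0..2 * pi} t \<partial>m) \<partial>lborel)"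
    by (rule Fubini'[OF meas])
  also have "\<dots> = (\<integral>\<^sup>+t. (\<integral>\<^sup>+\<zeta>. h \<zeta> \<partial>m) * indicator {0..2 * pi} t \<partial>lborel)"
  proof (rule nn_integral_cong)
    fix t :: real
    show "(\<integral>\<^sup>+\<zeta>. h (cis t *s \<zeta>) * indicator {0..2 * pi} t \<partial>m) = (\<integral>\<^sup>+\<zeta>. h \<zeta> \<partial>m) * indicator {0..2 * pi} t"
    proof (cases "t \<in> {0..2 * pi}")
      case True
      have "(\<integral>\<^sup>+\<zeta>. h \<zeta> \<partial>m) = (\<integral>\<^sup>+\<zeta>. h \<zeta> \<partial>distr m m (\<lambda>\<zeta>. cis t *s \<zeta>))"
        using rotate_m[OF True] by simp
      also have "\<dots> = (\<integral>\<^sup>+\<zeta>. h (cis t *s \<zeta>) \<partial>m)"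
        by (rule nn_integral_distr) (use h rotate_measurable in auto)
      finally show ?thesis using True by simp
    qed simp
  qed
  also have "\<dots> = ennreal (2 * pi) * (\<integral>\<^sup>+\<zeta>. h \<zeta> \<partial>m)"
    by (simp add: nn_integral_cmult mult.commute)
  finally show "(\<integral>\<^sup>+\<zeta>. (\<integral>\<^sup>+t. h (cis t *s \<zeta>) * indicator {0..2 * pi} t \<partial>lborel) \<partial>m) = ennreal (2 * pi) * (\<integral>\<^sup>+\<zeta>. h \<zeta> \<partial>m)" .
  have "(\<lambda>(\<zeta>, t). h (cis t *s \<zeta>) * indicator {0..2 * pi} t) \<in> borel_measurable (m \<Otimes>\<^sub>M lborel)"
    using measurable_pair_swap[OF meas] by (simp add: case_prod_beta)
  then show "(\<lambda>\<zeta>. \<integral>\<^sup>+t. h (cis t *s \<zeta>) * indicator {0..2 * pi} t \<partial>lborel) \<in> borel_measurable m"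
    using lborel.borel_measurable_nn_integral_fst by fastforce
qed

section \<open>Slices through boundary points and mean squares of dilates\<close>

lemma dilate_S: "\<zeta> \<in> S \<Longrightarrow> 0 \<le> r \<Longrightarrow> r < 1 \<Longrightarrow> r *\<^sub>R \<zeta> \<in> \<Omega>"
  using dilate S_subset by blast

lemma slice_in_domain:
  assumes "\<zeta> \<in> S" "cmod w < 1"
  shows "w *s \<zeta> \<in> \<Omega>"
proof -
  \<comment> \<open>Polar form of \<open>w\<close>: rotate first, which stays in \<open>S\<close>,
    then shrink into the domain.\<close>
  have "w *s \<zeta> = cmod w *\<^sub>R (cis (Arg w) *s \<zeta>)"
    by (simp add: scaleR_eq_vector_scalar_mult vector_smult_assoc rcis_cmod_Arg flip: rcis_def)
  then show ?thesis using dilate_S[OF rotate_S[OF assms(1)]] assms(2) by simp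
qed

lemma slice_holomorphic:
  assumes F: "holomorphic_vec F \<Omega>" and \<zeta>: "\<zeta> \<in> S"
  shows "(\<lambda>w. F (w *s \<zeta>)) holomorphic_on ball 0 1"
proof (rule holomorphic_onI)
  fix w :: complex assume "w \<in> ball 0 1"
  then have "w *s \<zeta> \<in> \<Omega>" using slice_in_domain[OF \<zeta>] by (simp add: dist_norm)
  then obtain D where D: "(F has_derivative D) (at (w *s \<zeta>))" "\<And>c v. D (c *s v) = c * D v"
    using F unfolding holomorphic_vec_def by blast
  have "bounded_linear (\<lambda>w. w *s \<zeta>)"
  proof (rule bounded_linear_intro[where K = "norm \<zeta>"])
    show "(x + y) *s \<zeta> = x *s \<zeta> + y *s \<zeta>" for x y by (rule vector_sadd_rdistrib)
    show "(r *\<^sub>R x) *s \<zeta> = r *\<^sub>R (x *s \<zeta>)" for r x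
      by (simp add: scaleR_eq_vector_scalar_mult vector_smult_assoc scaleR_conv_of_real)
  qed (simp add: norm_vector_scalar_mult)
  then have "((\<lambda>w. w *s \<zeta>) has_derivative (\<lambda>w. w *s \<zeta>)) (at w)"
    by (rule bounded_linear_imp_has_derivative)
  from has_derivative_compose[OF this D(1)]
  have "((\<lambda>w. F (w *s \<zeta>)) has_derivative (\<lambda>c. D \<zeta> * c)) (at w)"
    by (simp add: D(2) mult.commute)
  then have "((\<lambda>w. F (w *s \<zeta>)) has_field_derivative D \<zeta>) (at w)"
    by (simp add: has_field_derivative_def)
  then show "(\<lambda>w. F (w *s \<zeta>)) field_differentiable (at w within ball 0 1)"
    by (auto simp: field_differentiable_def intro: has_field_derivative_at_within)
qed

lemma dilate_borel_measurable:
  fixes F :: "complex^'n \<Rightarrow> complex"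
  assumes F: "continuous_on \<Omega> F" and r: "0 \<le> r" "r < 1"
  shows "(\<lambda>\<zeta>. F (r *\<^sub>R \<zeta>)) \<in> borel_measurable m"
proof -
  have "continuous_on S (\<lambda>\<zeta>. F (r *\<^sub>R \<zeta>))"
    by (rule continuous_on_compose2[OF F]) (use r dilate_S in \<open>auto intro!: continuous_intros\<close>)
  then show ?thesis
    unfolding borel_measurable_m_iff by (rule borel_measurable_continuous_on_restrict)
qed

text \<open>The circle relations hold on the slice through each \<open>\<zeta>\<close>; integrated
  over \<open>S\<close>, each circle mean becomes \<open>2 * pi\<close> times a squared norm, and
  the factor cancels. The second relation avoids subtraction because the values are extended
  nonnegative numbers.\<close>

lemma sqnorm_dilate:
  assumes F: "holomorphic_vec F \<Omega>" and r: "0 < r" "r < 1" and s: "0 < s" "s < 1"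
  shows "r \<le> s \<Longrightarrow> sqnorm m (\<lambda>\<zeta>. F (r *\<^sub>R \<zeta>)) \<le> sqnorm m (\<lambda>\<zeta>. F (s *\<^sub>R \<zeta>))"
    and "sqnorm m (\<lambda>\<zeta>. F (r *\<^sub>R \<zeta>) - F (s *\<^sub>R \<zeta>)) + 2 * sqnorm m (\<lambda>\<zeta>. F (sqrt (r * s) *\<^sub>R \<zeta>))
       = sqnorm m (\<lambda>\<zeta>. F (r *\<^sub>R \<zeta>)) + sqnorm m (\<lambda>\<zeta>. F (s *\<^sub>R \<zeta>))"
proof -
  have q: "0 < sqrt (r * s)" "sqrt (r * s) < 1"
    using r s mult_strict_mono[of r 1 s 1] by (auto simp: real_sqrt_less_iff)
  have meas[measurable]: "(\<lambda>\<zeta>. F (r *\<^sub>R \<zeta>)) \<in> borel_measurable m" if "0 < r" "r < 1" for r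
    using that by (intro dilate_borel_measurable holomorphic_vec_imp_continuous_on F) auto
  define A where "A r \<zeta> = (\<integral>\<^sup>+t. ennreal ((cmod (F (r *\<^sub>R (cis t *s \<zeta>))))\<^sup>2) * indicator {0..2 * pi} t \<partial>lborel)" for r \<zeta>
  define B where "B \<zeta> = (\<integral>\<^sup>+t. ennreal ((cmod (F (r *\<^sub>R (cis t *s \<zeta>)) - F (s *\<^sub>R (cis t *s \<zeta>))))\<^sup>2) * indicator {0..2 * pi} t \<partial>lborel)" for \<zeta>
  have A: "(\<integral>\<^sup>+\<zeta>. A r \<zeta> \<partial>m) = ennreal (2 * pi) * sqnorm m (\<lambda>\<zeta>. F (r *\<^sub>R \<zeta>))" "A r \<in> borel_measurable m"
    if "0 < r" "r < 1" for r
    using circle_average[of "\<lambda>\<zeta>. ennreal ((cmod (F (r *\<^sub>R \<zeta>)))\<^sup>2)"] meas[OF that] by (simp_all add: A_def[abs_def])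
  have B: "(\<integral>\<^sup>+\<zeta>. B \<zeta> \<partial>m) = ennreal (2 * pi) * sqnorm m (\<lambda>\<zeta>. F (r *\<^sub>R \<zeta>) - F (s *\<^sub>R \<zeta>))" "B \<in> borel_measurable m"
    using circle_average[of "\<lambda>\<zeta>. ennreal ((cmod (F (r *\<^sub>R \<zeta>) - F (s *\<^sub>R \<zeta>)))\<^sup>2)"] meas[OF r] meas[OF s]
    by (simp_all add: B_def[abs_def])
  have eq: "r *\<^sub>R (cis t *s \<zeta>) = (of_real r * cis t) *s \<zeta>" for r t \<zeta>
    by (simp add: scaleR_eq_vector_scalar_mult vector_smult_assoc)
  note circle = circle_mean_square[OF slice_holomorphic[OF F] r s, folded eq, folded A_def B_def]
  show "sqnorm m (\<lambda>\<zeta>. F (r *\<^sub>R \<zeta>)) \<le> sqnorm m (\<lambda>\<zeta>. F (s *\<^sub>R \<zeta>))" if "r \<le> s"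
  proof -
    have "ennreal (2 * pi) * sqnorm m (\<lambda>\<zeta>. F (r *\<^sub>R \<zeta>)) \<le> ennreal (2 * pi) * sqnorm m (\<lambda>\<zeta>. F (s *\<^sub>R \<zeta>))"
      unfolding A(1)[OF r, symmetric] A(1)[OF s, symmetric]
      by (intro nn_integral_mono circle(1) that) (simp add: space_m)
    then show ?thesis by (simp add: ennreal_mult_le_mult_iff)
  qed
  have "ennreal (2 * pi) * (sqnorm m (\<lambda>\<zeta>. F (r *\<^sub>R \<zeta>) - F (s *\<^sub>R \<zeta>)) + 2 * sqnorm m (\<lambda>\<zeta>. F (sqrt (r * s) *\<^sub>R \<zeta>)))
      = (\<integral>\<^sup>+\<zeta>. B \<zeta> + 2 * A (sqrt (r * s)) \<zeta> \<partial>m)"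
    using A[OF q] B by (simp add: nn_integral_add nn_integral_cmult distrib_left mult_ac)
  also have "\<dots> = (\<integral>\<^sup>+\<zeta>. A r \<zeta> + A s \<zeta> \<partial>m)"
    by (intro nn_integral_cong circle(2)) (simp add: space_m)
  also have "\<dots> = ennreal (2 * pi) * (sqnorm m (\<lambda>\<zeta>. F (r *\<^sub>R \<zeta>)) + sqnorm m (\<lambda>\<zeta>. F (s *\<^sub>R \<zeta>)))"
    using A[OF r] A[OF s] by (simp add: nn_integral_add distrib_left)
  finally show "sqnorm m (\<lambda>\<zeta>. F (r *\<^sub>R \<zeta>) - F (s *\<^sub>R \<zeta>)) + 2 * sqnorm m (\<lambda>\<zeta>. F (sqrt (r * s) *\<^sub>R \<zeta>))
       = sqnorm m (\<lambda>\<zeta>. F (r *\<^sub>R \<zeta>)) + sqnorm m (\<lambda>\<zeta>. F (s *\<^sub>R \<zeta>))"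
    by (simp add: ennreal_mult_cancel_left)
qed

lemma sqnorm_dilate_tendsto:
  assumes F: "holomorphic_vec F \<Omega>"
  shows "((\<lambda>r. sqnorm m (\<lambda>\<zeta>. F (r *\<^sub>R \<zeta>))) \<longlongrightarrow> (SUP r\<in>{0<..<1}. sqnorm m (\<lambda>\<zeta>. F (r *\<^sub>R \<zeta>)))) (at_left 1)"
proof (rule order_tendstoI)
  fix a assume "a < (SUP r\<in>{0<..<1::real}. sqnorm m (\<lambda>\<zeta>. F (r *\<^sub>R \<zeta>)))"
  then obtain q where q: "q \<in> {0<..<1}" "a < sqnorm m (\<lambda>\<zeta>. F (q *\<^sub>R \<zeta>))" by (auto simp: less_SUP_iff)
  have "\<forall>\<^sub>F r in at_left 1. r \<in> {q<..<1}"
    using q by (intro eventually_at_leftI[of q]) auto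
  then show "\<forall>\<^sub>F r in at_left 1. a < sqnorm m (\<lambda>\<zeta>. F (r *\<^sub>R \<zeta>))"
  proof eventually_elim
    case (elim r)
    then have "sqnorm m (\<lambda>\<zeta>. F (q *\<^sub>R \<zeta>)) \<le> sqnorm m (\<lambda>\<zeta>. F (r *\<^sub>R \<zeta>))"
      using q(1) by (intro sqnorm_dilate(1)[OF F]) auto
    with q(2) show ?case by (rule less_le_trans)
  qed
next
  fix a assume a: "(SUP r\<in>{0<..<1::real}. sqnorm m (\<lambda>\<zeta>. F (r *\<^sub>R \<zeta>))) < a"
  have "\<forall>\<^sub>F r::real in at_left 1. r \<in> {0<..<1}" by (intro eventually_at_leftI[of 0]) auto
  then show "\<forall>\<^sub>F r in at_left 1. sqnorm m (\<lambda>\<zeta>. F (r *\<^sub>R \<zeta>)) < a"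
  proof eventually_elim
    case (elim r)
    have "sqnorm m (\<lambda>\<zeta>. F (r *\<^sub>R \<zeta>)) \<le> (SUP r\<in>{0<..<1::real}. sqnorm m (\<lambda>\<zeta>. F (r *\<^sub>R \<zeta>)))"
      using elim by (rule SUP_upper)
    then show ?case using a by (rule le_less_trans)
  qed
qed

text \<open>Let \<open>L\<close> be the supremum of the squared norms. If the squared norm at
  \<open>q\<close> exceeds \<open>L - \<epsilon> / 2\<close>, then so does the one at
  \<open>sqrt (r * s)\<close>, as \<open>r\<close> and \<open>s\<close> exceed \<open>q\<close>. The
  relation for two radii then bounds the squared difference by
  \<open>2 * L - 2 * (L - \<epsilon> / 2) = \<epsilon>\<close>; finiteness of \<open>L\<close>
  permits the cancellation.\<close>

lemma sqnorm_dilate_cauchy: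
  assumes F: "holomorphic_vec F \<Omega>" and fin: "(SUP r\<in>{0<..<1::real}. sqnorm m (\<lambda>\<zeta>. F (r *\<^sub>R \<zeta>))) < \<infinity>"
    and \<epsilon>: "0 < (\<epsilon>::real)"
  shows "\<exists>q\<in>{0<..<1}. \<forall>r\<in>{q<..<1}. \<forall>s\<in>{q<..<1}.
     sqnorm m (\<lambda>\<zeta>. F (r *\<^sub>R \<zeta>) - F (s *\<^sub>R \<zeta>)) \<le> ennreal \<epsilon>"
proof -
  define N where "N r = sqnorm m (\<lambda>\<zeta>. F (r *\<^sub>R \<zeta>))" for r :: real
  define L where "L = (SUP r\<in>{0<..<1}. N r)"
  have L: "L \<noteq> \<infinity>" using fin unfolding L_def N_def by (rule less_imp_neq)
  have NL: "N r \<le> L" if "r \<in> {0<..<1}" for r unfolding L_def using that by (rule SUP_upper)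
  obtain q where q: "q \<in> {0<..<1}" "L < N q + ennreal (\<epsilon> / 2)"
    using SUP_approx_ennreal[OF _ _ L_def, of "\<epsilon> / 2"] \<epsilon> L by auto
  have "sqnorm m (\<lambda>\<zeta>. F (r *\<^sub>R \<zeta>) - F (s *\<^sub>R \<zeta>)) \<le> ennreal \<epsilon>" if r: "r \<in> {q<..<1}" and s: "s \<in> {q<..<1}" for r s
  proof -
    define p where "p = sqrt (r * s)"
    have rs: "0 < r" "r < 1" "0 < s" "s < 1" using r s q by auto
    have "q * q \<le> r * s" using r s q by (intro mult_mono) auto
    then have "q \<le> p" unfolding p_def by (intro real_le_rsqrt) (simp add: power2_eq_square)
    moreover have "p < 1" using rs mult_strict_mono[of r 1 s 1] by (auto simp: p_def real_sqrt_less_iff)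
    ultimately have p: "p \<in> {0<..<1}" "N q \<le> N p"
      using q(1) unfolding N_def by (auto intro!: sqnorm_dilate(1)[OF F])
    have "L \<le> N p + ennreal (\<epsilon> / 2)"
      using less_imp_le[OF q(2)] add_right_mono[OF p(2)] by (rule order_trans)
    then have "L + L \<le> (N p + ennreal (\<epsilon> / 2)) + (N p + ennreal (\<epsilon> / 2))" by (intro add_mono)
    also have "\<dots> = 2 * N p + ennreal \<epsilon>"
    proof -
      have "ennreal \<epsilon> = ennreal (\<epsilon> / 2) + ennreal (\<epsilon> / 2)"
        using \<epsilon> by (subst ennreal_plus[symmetric]) auto
      then show ?thesis by (simp add: mult_2 add_ac)
    qed
    finally have "L + L \<le> 2 * N p + ennreal \<epsilon>" .
    moreover have "sqnorm m (\<lambda>\<zeta>. F (r *\<^sub>R \<zeta>) - F (s *\<^sub>R \<zeta>)) + 2 * N p \<le> L + L"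
      using sqnorm_dilate(2)[OF F rs] add_mono[OF NL NL, of r s] rs by (simp add: N_def p_def)
    ultimately have "2 * N p + sqnorm m (\<lambda>\<zeta>. F (r *\<^sub>R \<zeta>) - F (s *\<^sub>R \<zeta>)) \<le> 2 * N p + ennreal \<epsilon>"
      by (subst add.commute) (rule order_trans)
    moreover have "2 * N p \<noteq> \<infinity>" using NL[OF p(1)] L by (auto simp: ennreal_mult_eq_top_iff top_unique)
    ultimately show ?thesis by (simp add: ennreal_add_left_cancel_le)
  qed
  with q(1) show ?thesis by blast
qed

end

section \<open>The ball and the polydisc\<close>

text \<open>The shape shared by both boundary measures: a uniform parameter in \<open>D\<close>,
  cube or ball, is sent to the boundary by \<open>E\<close>. Invariance under a map of the boundary
  is thereby reduced to Lebesgue measure of parameter sets.\<close>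

lemma restrict_distr_uniform_measure:
  fixes E :: "'b::euclidean_space \<Rightarrow> 'a::topological_space"
  assumes [measurable]: "D \<in> sets borel" "E \<in> borel_measurable borel" "S \<in> sets borel"
    and D: "emeasure lborel D \<noteq> 0" "emeasure lborel D \<noteq> \<infinity>"
  defines "m \<equiv> restrict_space (distr (uniform_measure lborel D) borel E) S"
  shows "sets m = sets (restrict_space borel S)"
    and "finite_measure m"
    and "\<And>T. T \<in> borel_measurable borel \<Longrightarrow> (\<And>z. T z \<in> S \<longleftrightarrow> z \<in> S) \<Longrightarrow>
       (\<And>A. A \<in> sets borel \<Longrightarrow> A \<subseteq> S \<Longrightarrow>
          emeasure lborel (D \<inter> {x. T (E x) \<in> A}) = emeasure lborel (D \<inter> {x. E x \<in> A})) \<Longrightarrow>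
       distr m m T = m"
proof -
  show sets_m: "sets m = sets (restrict_space borel S)"
    unfolding m_def by (simp add: sets_restrict_space)
  have space_m: "space m = S" using sets_eq_imp_space_eq[OF sets_m] by (simp add: space_restrict_space)
  have in_sets: "A \<in> sets m \<longleftrightarrow> A \<in> sets borel \<and> A \<subseteq> S" for A
    unfolding sets_m by (subst sets_restrict_space_iff) auto
  have em: "emeasure m A = emeasure lborel (D \<inter> {x. E x \<in> A}) / emeasure lborel D" if "A \<in> sets m" for A
  proof -
    have [measurable]: "A \<in> sets borel" and "A \<subseteq> S" using that by (auto simp: in_sets)
    then show ?thesis
      unfolding m_def
      by (subst emeasure_restrict_space) (auto simp: emeasure_distr vimage_def)
  qed
  show "finite_measure m"
  proof (rule finite_measureI)
    have "emeasure lborel (D \<inter> {x. E x \<in> S}) \<le> emeasure lborel D"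
      by (rule emeasure_mono) auto
    then have "emeasure lborel (D \<inter> {x. E x \<in> S}) \<noteq> \<infinity>" using D(2) by (auto simp: top_unique)
    then show "emeasure m (space m) \<noteq> \<infinity>"
      using D by (subst em) (auto simp: space_m in_sets ennreal_divide_eq_top_iff)
  qed
  fix T :: "'a \<Rightarrow> 'a"
  assume T[measurable]: "T \<in> borel_measurable borel" and TS: "\<And>z. T z \<in> S \<longleftrightarrow> z \<in> S"
    and inv: "\<And>A. A \<in> sets borel \<Longrightarrow> A \<subseteq> S \<Longrightarrow>
          emeasure lborel (D \<inter> {x. T (E x) \<in> A}) = emeasure lborel (D \<inter> {x. E x \<in> A})"
  have pre: "T -` A \<inter> S = {z. T z \<in> A}" "{z. T z \<in> A} \<subseteq> S" if "A \<subseteq> S" for A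
    using that TS by auto
  have Tm: "T \<in> measurable m m"
  proof (rule measurableI)
    fix A assume "A \<in> sets m"
    then have A: "A \<in> sets borel" "A \<subseteq> S" by (simp_all add: in_sets)
    then have "{z. T z \<in> A} \<in> sets borel" using measurable_sets_borel[OF T, of A] by (simp add: vimage_def)
    then show "T -` A \<inter> space m \<in> sets m"
      using pre[OF A(2)] by (simp add: space_m in_sets)
  qed (simp add: space_m TS)
  show "distr m m T = m"
  proof (rule measure_eqI)
    fix A assume "A \<in> sets (distr m m T)"
    then have A: "A \<in> sets m" by simp
    have "{z. T z \<in> A} \<in> sets m"
      using measurable_sets[OF Tm A] A by (simp add: space_m pre in_sets)
    then show "emeasure (distr m m T) A = emeasure m A"
      using A by (simp add: emeasure_distr[OF Tm A] space_m pre in_sets em inv)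
  qed simp
qed

lemma in_closure_if_dilates:
  fixes z :: "'a::real_normed_vector"
  assumes "\<And>r. 0 \<le> r \<Longrightarrow> r < 1 \<Longrightarrow> r *\<^sub>R z \<in> X"
  shows "z \<in> closure X"
  unfolding closure_sequential
proof (intro exI conjI allI)
  show "(real n / real (Suc n)) *\<^sub>R z \<in> X" for n by (rule assms) auto
  have "(\<lambda>n. (real n / real (Suc n)) *\<^sub>R z) \<longlonglongrightarrow> 1 *\<^sub>R z"
    by (intro tendsto_scaleR tendsto_const LIMSEQ_n_over_Suc_n)
  then show "(\<lambda>n. (real n / real (Suc n)) *\<^sub>R z) \<longlonglongrightarrow> z" by simp
qed

lemma rotate_borel_measurable: "(\<lambda>z::complex^'n. cis t *s z) \<in> borel_measurable borel"
  by (intro borel_measurable_continuous_onI continuous_on_vector_scalar_mult continuous_intros)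

lemma rotate_orthogonal: "orthogonal_transformation (\<lambda>z::complex^'n. cis t *s z)"
proof -
  have "linear (\<lambda>z::complex^'n. cis t *s z)"
    by (rule linearI) (simp_all add: scaleR_eq_vector_scalar_mult vector_add_ldistrib vector_smult_assoc mult.commute)
  then show ?thesis by (simp add: orthogonal_transformation norm_vector_scalar_mult)
qed

lemma circular_domain_ball: "circular_domain (sphere_measure :: (complex^'n) measure) (ball 0 1) (sphere 0 1) 1"
proof -
  have E: "(\<lambda>z::complex^'n. z /\<^sub>R norm z) \<in> borel_measurable borel" by measurable
  have "emeasure lborel (ball (0::complex^'n) 1) \<noteq> 0" "emeasure lborel (ball (0::complex^'n) 1) \<noteq> \<infinity>"
    using unit_ball_vol_pos[of "DIM(complex^'n)"] by (simp_all add: emeasure_ball ennreal_eq_0_iff not_le)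
  note m = restrict_distr_uniform_measure[OF _ E _ this, of "sphere 0 1", folded sphere_measure_def, simplified]
  show ?thesis
  proof (intro circular_domain.intro circular_domain_axioms.intro m(1,2))
    fix t :: real
    note [measurable] = rotate_borel_measurable[of t, where 'n = 'n] E
    show "distr sphere_measure sphere_measure (\<lambda>\<zeta>. cis t *s \<zeta>) = (sphere_measure :: (complex^'n) measure)"
    proof (rule m(3))
      fix A :: "(complex^'n) set" assume [measurable]: "A \<in> sets borel"
      \<comment> \<open>Rotation commutes with radial projection, also at the origin, where both
        sides are 0. Since rotation preserves the unit ball, invariance follows from that of
        Lebesgue measure.\<close>
      have eq: "cis t *s (x /\<^sub>R norm x) = (cis t *s x) /\<^sub>R norm (cis t *s x)" for x :: "complex^'n"
        by (simp add: norm_vector_scalar_mult scaleR_eq_vector_scalar_mult vector_smult_assoc mult.commute)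
      have "emeasure lborel (ball 0 1 \<inter> {x. x /\<^sub>R norm x \<in> A})
          = emeasure (distr lborel borel (\<lambda>z. cis t *s z)) (ball 0 1 \<inter> {x. x /\<^sub>R norm x \<in> A})"
        by (simp add: lborel_distr_orthogonal[OF rotate_orthogonal])
      also have "\<dots> = emeasure lborel ((\<lambda>z. cis t *s z) -` (ball 0 1 \<inter> {x. x /\<^sub>R norm x \<in> A}))"
        by (subst emeasure_distr) auto
      also have "(\<lambda>z. cis t *s z) -` (ball 0 1 \<inter> {x. x /\<^sub>R norm x \<in> A}) = ball 0 1 \<inter> {x. cis t *s (x /\<^sub>R norm x) \<in> A}"
        unfolding eq by (auto simp: norm_vector_scalar_mult)
      finally show "emeasure lborel (ball 0 1 \<inter> {x. cis t *s (x /\<^sub>R norm x) \<in> A})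
         = emeasure lborel (ball 0 1 \<inter> {x. x /\<^sub>R norm x \<in> A})" by simp
    qed (simp_all add: norm_vector_scalar_mult rotate_borel_measurable)
  next
    fix z :: "complex^'n" and r :: real assume "z \<in> closure (ball 0 1)" "0 \<le> r" "r < 1"
    then show "r *\<^sub>R z \<in> ball 0 1"
      using mult_left_mono[of "norm z" 1 r] by (simp add: closure_ball)
  qed (auto simp: norm_vector_scalar_mult closure_ball)
qed

lemma sum_Basis_nth: "(\<Sum>b\<in>Basis. (b :: real^'n) $ i) = 1"
  using inner_sum_left_Basis[of "axis i 1 :: real^'n" "\<lambda>_. 1"]
  by (simp add: axis_in_Basis_iff inner_axis)

lemma circular_domain_polydisc:
  "circular_domain (torus_measure :: (complex^'n) measure) polydisc torus (sqrt CARD('n))"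
proof -
  define E where "E t = (\<chi> i. cis (t $ i))" for t :: "real^'n"
  define D where "D = cbox 0 ((2 * pi) *\<^sub>R (One :: real^'n))"
  have D_eq: "D = cbox 0 (\<chi> i. 2 * pi)"
  proof -
    have "(2 * pi) *\<^sub>R (One :: real^'n) = (\<chi> i. 2 * pi)" by (simp add: vec_eq_iff sum_Basis_nth)
    then show ?thesis by (simp add: D_def)
  qed
  have contE: "continuous_on UNIV E"
    unfolding E_def[abs_def] by (intro continuous_on_vec_lambda continuous_on_cis continuous_intros)
  then have E[measurable]: "E \<in> borel_measurable borel" by (rule borel_measurable_continuous_onI)
  have closed_le: "closed {z::complex^'n. \<forall>i. cmod (z $ i) \<le> 1}"
    by (intro closed_Collect_all closed_Collect_le continuous_intros)
  have closed_torus: "closed (torus :: (complex^'n) set)"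
    unfolding torus_def by (intro closed_Collect_all closed_Collect_eq continuous_intros)
  have "emeasure lborel D = ennreal (\<Prod>b\<in>(Basis::(real^'n) set). 2 * pi)"
    unfolding D_def by (subst emeasure_lborel_cbox) (auto intro!: arg_cong[where f=ennreal] prod.cong)
  then have D: "emeasure lborel D \<noteq> 0" "emeasure lborel D \<noteq> \<infinity>" by (simp_all add: ennreal_eq_0_iff not_le)
  have m_eq: "torus_measure = restrict_space (distr (uniform_measure lborel D) borel E) torus"
    by (simp add: torus_measure_def D_eq E_def[abs_def])
  have D_borel: "D \<in> sets borel" and torus_borel: "(torus :: (complex^'n) set) \<in> sets borel"
    using closed_torus by (auto simp: D_def)
  note m = restrict_distr_uniform_measure[OF D_borel E torus_borel D, folded m_eq]
  have dil: "r *\<^sub>R z \<in> polydisc" if "\<forall>i. cmod (z $ i) \<le> 1" "0 \<le> r" "r < 1" for z :: "complex^'n" and r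
    unfolding polydisc_def mem_Collect_eq
  proof
    fix i
    have "r * cmod (z $ i) \<le> r * 1" using that by (intro mult_left_mono) auto
    then show "cmod ((r *\<^sub>R z) $ i) < 1" using that by simp
  qed
  \<comment> \<open>The closed polydisc lies in the Euclidean ball of radius
    \<open>sqrt CARD('n)\<close>, whose sphere contains the torus.\<close>
  have norm_le: "norm z \<le> sqrt CARD('n)" if "\<forall>i. cmod (z $ i) \<le> 1" for z :: "complex^'n"
  proof -
    have "(\<Sum>i\<in>UNIV. (cmod (z $ i))\<^sup>2) \<le> (\<Sum>i\<in>(UNIV::'n set). 1)"
      using that by (intro sum_mono) (simp add: power_le_one)
    then show ?thesis by (simp add: norm_vec_def L2_set_def)
  qed
  show ?thesis
  proof (intro circular_domain.intro circular_domain_axioms.intro m(1,2))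
    fix t :: real assume t: "t \<in> {0..2 * pi}"
    show "distr torus_measure torus_measure (\<lambda>\<zeta>. cis t *s \<zeta>) = (torus_measure :: (complex^'n) measure)"
    proof (rule m(3))
      fix A :: "(complex^'n) set" assume A[measurable]: "A \<in> sets borel"
      \<comment> \<open>Adding \<open>t\<close> to every angle is the scalar rotation by
        \<open>cis t\<close>, so the diagonal shift of the period cube applies.\<close>
      have shift: "E (x + t *\<^sub>R One) = cis t *s E x" for x
        by (simp add: E_def vec_eq_iff sum_Basis_nth cis_mult add.commute)
      have per: "E (x + (2 * pi) *\<^sub>R b) = E x" if b: "b \<in> Basis" for x b
      proof -
        obtain j where "b = axis j 1" using b by (auto simp: Basis_vec_def)
        then show ?thesis by (simp add: E_def vec_eq_iff axis_def cis_mult[symmetric])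
      qed
      have "emeasure lborel {x \<in> D. x + t *\<^sub>R One \<in> {x. E x \<in> A}} = emeasure lborel (D \<inter> {x. E x \<in> A})"
        unfolding D_def using t by (intro emeasure_lborel_cube_shift) (auto simp: per)
      then show "emeasure lborel (D \<inter> {x. cis t *s E x \<in> A}) = emeasure lborel (D \<inter> {x. E x \<in> A})"
        by (simp add: shift Int_def)
    qed (simp_all add: rotate_borel_measurable torus_def norm_mult)
  next
    fix z :: "complex^'n" and r :: real assume z: "z \<in> closure polydisc" and r: "0 \<le> r" "r < 1"
    have "closure polydisc \<subseteq> {z::complex^'n. \<forall>i. cmod (z $ i) \<le> 1}"
      by (intro closure_minimal closed_le) (auto simp: polydisc_def less_imp_le)
    then show "r *\<^sub>R z \<in> polydisc" using z r by (intro dil) auto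
  next
    show "torus \<subseteq> closure (polydisc :: (complex^'n) set)"
      by (auto intro!: in_closure_if_dilates dil simp: torus_def)
    show "polydisc \<subseteq> cball (0 :: complex^'n) (sqrt CARD('n))"
      using norm_le by (auto simp: polydisc_def less_imp_le)
    show "norm \<zeta> = sqrt CARD('n)" if "\<zeta> \<in> torus" for \<zeta> :: "complex^'n"
      using that by (simp add: torus_def norm_vec_def L2_set_def)
  qed (auto simp: torus_def norm_mult)
qed

section \<open>The isometric embedding\<close>

text \<open>The analytic core. The group and the representation enter only through the behaviour of
  \<open>\<theta>\<close> and \<open>\<ll>\<close> under real dilation, and through the position of
  the image of \<open>S\<close>.\<close>

lemma (in circular_domain) hardy_embedding:
  fixes \<theta> :: "complex^'n \<Rightarrow> complex^'n" and \<ll> :: "complex^'n \<Rightarrow> complex" and k :: "'n \<Rightarrow> nat"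
  assumes \<theta>_hol: "\<And>i. holomorphic_vec (\<lambda>z. \<theta> z $ i) UNIV" and \<ll>_hol: "holomorphic_vec \<ll> UNIV"
    and \<theta>_hom: "\<And>r z i. \<theta> (r *\<^sub>R z) $ i = of_real r ^ k i * \<theta> z $ i"
    and \<ll>_hom: "\<And>r z. \<ll> (r *\<^sub>R z) = of_real r ^ d * \<ll> z"
    and \<theta>_S: "\<theta> ` S \<subseteq> shilov_boundary (\<theta> ` \<Omega>)"
  defines "M \<equiv> weighted_boundary_measure \<Omega> m \<theta> \<ll>"
  shows "\<exists>T :: (complex^'n \<Rightarrow> complex) \<Rightarrow> (complex^'n \<Rightarrow> complex).
     (\<forall>f\<in>H2_space \<Omega> m \<theta> \<ll>. T f \<in> L2_space M) \<and>
     (\<forall>f\<in>H2_space \<Omega> m \<theta> \<ll>. \<forall>g\<in>H2_space \<Omega> m \<theta> \<ll>. \<forall>a b :: complex.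
        (\<lambda>w. a * f w + b * g w) \<in> H2_space \<Omega> m \<theta> \<ll> \<and>
        (AE w in M. T (\<lambda>w. a * f w + b * g w) w = a * T f w + b * T g w)) \<and>
     (\<forall>f\<in>H2_space \<Omega> m \<theta> \<ll>. L2_norm G M (T f) = H2_norm G m \<theta> \<ll> f) \<and>
     (\<forall>f\<in>H2_space \<Omega> m \<theta> \<ll>. boundary_value m \<theta> \<ll> f (T f))"
proof -
  define Sh where "Sh = shilov_boundary (\<theta> ` \<Omega>)"
  \<comment> \<open>The weighted dilation, with the degrees of the components of
    \<open>\<theta>\<close> as weights, that corresponds under \<open>\<theta>\<close> to
    multiplication by \<open>r\<close>.\<close>
  define \<delta> where "\<delta> r w = (\<chi> i. of_real r ^ k i * w $ i)" for r :: real and w :: "complex^'n"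
  define u where "u f r w = of_real r ^ d * f (\<delta> r w)" for f :: "complex^'n \<Rightarrow> complex" and r :: real and w
  define F where "F f z = f (\<theta> z) * \<ll> z" for f :: "complex^'n \<Rightarrow> complex" and z
  have \<delta>: "\<theta> (r *\<^sub>R z) = \<delta> r (\<theta> z)" for r z by (simp add: vec_eq_iff \<theta>_hom \<delta>_def)
  have F_dilate: "F f (r *\<^sub>R \<zeta>) = u f r (\<theta> \<zeta>) * \<ll> \<zeta>" for f r \<zeta>
    by (simp add: F_def u_def \<ll>_hom \<delta>)
  have F_hol: "holomorphic_vec (F f) \<Omega>" if "holomorphic_vec f (\<theta> ` \<Omega>)" for f
    unfolding F_def[abs_def]
    by (rule holomorphic_vec_mult[OF holomorphic_vec_compose[OF that holomorphic_vec_subset[OF \<theta>_hol]]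
          holomorphic_vec_subset[OF \<ll>_hol]]) auto
  have hardy_sup: "hardy_sup m \<theta> \<ll> f = (SUP r\<in>{0<..<1}. sqnorm m (\<lambda>\<zeta>. F f (r *\<^sub>R \<zeta>)))" for f
    by (simp add: hardy_sup_def F_def norm_mult power_mult_distrib)
  have \<theta>_cont: "continuous_on X \<theta>" for X
  proof -
    have "continuous_on X (\<lambda>z. \<chi> i. \<theta> z $ i)"
      by (intro continuous_on_vec_lambda continuous_on_subset[OF holomorphic_vec_imp_continuous_on[OF \<theta>_hol]]) auto
    then show ?thesis by simp
  qed
  have "bounded \<Omega>" using \<Omega>_subset bounded_cball bounded_subset by blast
  have Sh: "\<exists>z\<in>closure \<Omega>. w = \<theta> z" if "w \<in> Sh" for w
    using that shilov_boundary_subset_closure closure_image_subset[OF \<open>bounded \<Omega>\<close> \<theta>_cont] unfolding Sh_def by blast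
  have \<theta>_meas: "\<theta> \<in> measurable m (restrict_space borel Sh)"
  proof (rule measurable_restrict_space2)
    show "\<theta> \<in> space m \<rightarrow> Sh" using \<theta>_S by (auto simp: space_m Sh_def)
    show "\<theta> \<in> borel_measurable m"
      using measurable_compose[OF measurable_ident_m borel_measurable_continuous_onI[OF \<theta>_cont]] .
  qed
  have [measurable]: "\<ll> \<in> borel_measurable m"
    using measurable_compose[OF measurable_ident_m
        borel_measurable_continuous_onI[OF holomorphic_vec_imp_continuous_on[OF \<ll>_hol]]] .
  have sets_M: "sets M = sets (restrict_space borel Sh)"
    by (simp add: M_def weighted_boundary_measure_def Sh_def)
  \<comment> \<open>The density \<open>|\<ll>|^2\<close> is absorbed as a factor
    \<open>\<ll>\<close>; together with \<open>F_dilate\<close> this identifies \<open>u f r\<close>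
    over \<open>M\<close> with the dilate of \<open>F f\<close> over \<open>m\<close>.\<close>
  have transfer: "sqnorm M g = sqnorm m (\<lambda>\<zeta>. g (\<theta> \<zeta>) * \<ll> \<zeta>)" if "g \<in> borel_measurable M" for g
  proof -
    have g: "g \<in> borel_measurable (restrict_space borel Sh)"
      using that unfolding measurable_cong_sets[OF sets_M refl] .
    note [measurable] = g
    have [measurable]: "(\<lambda>\<zeta>. g (\<theta> \<zeta>)) \<in> borel_measurable m"
      by (rule measurable_compose[OF \<theta>_meas g])
    have "sqnorm M g = (\<integral>\<^sup>+\<zeta>. ennreal ((cmod (g (\<theta> \<zeta>)))\<^sup>2) \<partial>density m (\<lambda>\<zeta>. ennreal ((cmod (\<ll> \<zeta>))\<^sup>2)))"
      unfolding M_def weighted_boundary_measure_def Sh_def[symmetric]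
      by (rule nn_integral_distr) (simp_all add: \<theta>_meas)
    also have "\<dots> = (\<integral>\<^sup>+\<zeta>. ennreal ((cmod (\<ll> \<zeta>))\<^sup>2) * ennreal ((cmod (g (\<theta> \<zeta>)))\<^sup>2) \<partial>m)"
      by (rule nn_integral_density) measurable
    finally show ?thesis by (simp add: norm_mult power_mult_distrib ennreal_mult mult.commute)
  qed
  have u_meas: "u f r \<in> borel_measurable M" if f: "holomorphic_vec f (\<theta> ` \<Omega>)" and r: "r \<in> {0<..<1}" for f r
  proof -
    have "\<delta> r w \<in> \<theta> ` \<Omega>" if w: "w \<in> Sh" for w
    proof -
      obtain z where z: "z \<in> closure \<Omega>" "w = \<theta> z" using Sh[OF w] by blast
      have "r *\<^sub>R z \<in> \<Omega>" using r by (intro dilate z(1)) auto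
      then show ?thesis unfolding z(2) \<delta>[symmetric] by (rule imageI)
    qed
    moreover have "continuous_on Sh (\<delta> r)"
      unfolding \<delta>_def[abs_def] by (intro continuous_on_vec_lambda continuous_intros)
    ultimately have "continuous_on Sh (\<lambda>w. f (\<delta> r w))"
      by (intro continuous_on_compose2[OF holomorphic_vec_imp_continuous_on[OF f]]) auto
    then have "continuous_on Sh (u f r)"
      unfolding u_def[abs_def] by (intro continuous_intros)
    then show ?thesis
      unfolding measurable_cong_sets[OF sets_M refl] by (rule borel_measurable_continuous_on_restrict)
  qed
  have near1: "\<forall>\<^sub>F r::real in at_left 1. r \<in> {0<..<1}"
    by (intro eventually_at_leftI[of 0]) auto
  have u_meas': "\<forall>\<^sub>F r in at_left 1. u f r \<in> borel_measurable M" if "holomorphic_vec f (\<theta> ` \<Omega>)" for f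
    using near1 by eventually_elim (rule u_meas[OF that])
  have H2: "holomorphic_vec f (\<theta> ` \<Omega>)" "(SUP r\<in>{0<..<1::real}. sqnorm m (\<lambda>\<zeta>. F f (r *\<^sub>R \<zeta>))) < \<infinity>"
    if "f \<in> H2_space \<Omega> m \<theta> \<ll>" for f
    using that by (simp_all add: H2_space_def hardy_sup)
  define bv where "bv f g \<longleftrightarrow> g \<in> borel_measurable M \<and>
     ((\<lambda>r. sqnorm M (\<lambda>w. u f r w - g w)) \<longlongrightarrow> 0) (at_left 1)" for f g
  have "\<forall>f\<in>H2_space \<Omega> m \<theta> \<ll>. \<exists>g. bv f g"
  proof
    fix f assume f: "f \<in> H2_space \<Omega> m \<theta> \<ll>"
    have cauchy: "\<exists>q\<in>{0<..<1}. \<forall>r\<in>{q<..<1}. \<forall>s\<in>{q<..<1}. sqnorm M (\<lambda>w. u f r w - u f s w) \<le> ennreal \<epsilon>"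
      if \<epsilon>: "0 < \<epsilon>" for \<epsilon> :: real
    proof -
      obtain q where q: "q \<in> {0<..<1}"
        "\<And>r s. r \<in> {q<..<1} \<Longrightarrow> s \<in> {q<..<1} \<Longrightarrow> sqnorm m (\<lambda>\<zeta>. F f (r *\<^sub>R \<zeta>) - F f (s *\<^sub>R \<zeta>)) \<le> ennreal \<epsilon>"
        using sqnorm_dilate_cauchy[OF F_hol[OF H2(1)[OF f]] H2(2)[OF f] \<epsilon>] by blast
      have "sqnorm M (\<lambda>w. u f r w - u f s w) \<le> ennreal \<epsilon>" if rs: "r \<in> {q<..<1}" "s \<in> {q<..<1}" for r s
      proof -
        have [measurable]: "u f r \<in> borel_measurable M" "u f s \<in> borel_measurable M"
          using rs q(1) by (auto intro!: u_meas H2(1)[OF f])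
        have "sqnorm M (\<lambda>w. u f r w - u f s w) = sqnorm m (\<lambda>\<zeta>. F f (r *\<^sub>R \<zeta>) - F f (s *\<^sub>R \<zeta>))"
          by (subst transfer) (simp_all add: F_dilate left_diff_distrib)
        with q(2)[OF rs] show ?thesis by simp
      qed
      with q(1) show ?thesis by blast
    qed
    obtain g where "g \<in> borel_measurable M"
      "((\<lambda>r. sqnorm M (\<lambda>w. u f r w - g w)) \<longlongrightarrow> 0) (at_left 1)"
      by (rule L2_cauchy_at_left_converges[OF u_meas[OF H2(1)[OF f]] cauchy])
    then show "\<exists>g. bv f g" unfolding bv_def by (intro exI conjI)
  qed
  \<comment> \<open>Each boundary value is chosen separately and is determined only up to null sets.
    Linearity is therefore not built in; it is recovered almost everywhere from uniqueness of
    limits.\<close>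
  then obtain T where "\<forall>f\<in>H2_space \<Omega> m \<theta> \<ll>. bv f (T f)" by (rule bchoice[THEN exE])
  then have T: "T f \<in> borel_measurable M" "((\<lambda>r. sqnorm M (\<lambda>w. u f r w - T f w)) \<longlongrightarrow> 0) (at_left 1)"
    if "f \<in> H2_space \<Omega> m \<theta> \<ll>" for f
    using that by (auto simp: bv_def)
  \<comment> \<open>The squared norms of \<open>u f r\<close> tend to that of their limit; being
    those of the dilates of \<open>F f\<close>, they also tend to their supremum, by
    monotonicity.\<close>
  have norm_T: "sqnorm M (T f) = hardy_sup m \<theta> \<ll> f" if f: "f \<in> H2_space \<Omega> m \<theta> \<ll>" for f
  proof (rule sqnorm_tendsto_unique[OF _ u_meas'[OF H2(1)[OF f]] T[OF f]])
    have "\<forall>\<^sub>F r in at_left 1. sqnorm m (\<lambda>\<zeta>. F f (r *\<^sub>R \<zeta>)) = sqnorm M (u f r)"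
      using u_meas'[OF H2(1)[OF f]] by eventually_elim (simp add: transfer F_dilate)
    with sqnorm_dilate_tendsto[OF F_hol[OF H2(1)[OF f]]]
    show "((\<lambda>r. sqnorm M (u f r)) \<longlongrightarrow> hardy_sup m \<theta> \<ll> f) (at_left 1)"
      unfolding hardy_sup by (rule Lim_transform_eventually)
  qed simp
  have boundary: "boundary_value m \<theta> \<ll> f (T f)" if f: "f \<in> H2_space \<Omega> m \<theta> \<ll>" for f
  proof -
    note [measurable] = T(1)[OF f]
    have "\<forall>\<^sub>F r in at_left 1. sqnorm M (\<lambda>w. u f r w - T f w)
        = sqnorm m (\<lambda>\<zeta>. F f (r *\<^sub>R \<zeta>) - T f (\<theta> \<zeta>) * \<ll> \<zeta>)"
      using u_meas'[OF H2(1)[OF f]]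
    proof eventually_elim
      case (elim r)
      note [measurable] = elim
      show ?case by (subst transfer) (simp_all add: F_dilate left_diff_distrib)
    qed
    then show ?thesis
      unfolding boundary_value_def F_def[symmetric] by (rule Lim_transform_eventually[OF T(2)[OF f]])
  qed
  have L2: "T f \<in> L2_space M" "L2_norm G M (T f) = H2_norm G m \<theta> \<ll> f" if f: "f \<in> H2_space \<Omega> m \<theta> \<ll>" for f
  proof -
    note [measurable] = T(1)[OF f]
    have "sqnorm M (T f) < \<infinity>" using f by (simp add: norm_T[OF f] H2_space_def)
    then show "T f \<in> L2_space M"
      by (simp add: L2_space_def T(1)[OF f] integrable_iff_bounded)
    \<comment> \<open>Both norms divide by \<open>card G\<close> under the root, so it is enough to
      compare the squared integrals.\<close>
    have "(\<integral>w. (cmod (T f w))\<^sup>2 \<partial>M) = enn2real (sqnorm M (T f))"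
      by (rule integral_eq_nn_integral) auto
    then show "L2_norm G M (T f) = H2_norm G m \<theta> \<ll> f"
      by (simp add: L2_norm_def H2_norm_def norm_T[OF f])
  qed
  have lincomb: "(\<lambda>w. a * f w + b * g w) \<in> H2_space \<Omega> m \<theta> \<ll>"
    if f: "f \<in> H2_space \<Omega> m \<theta> \<ll>" and g: "g \<in> H2_space \<Omega> m \<theta> \<ll>" for f g a b
  proof -
    let ?h = "\<lambda>w. a * f w + b * g w"
    \<comment> \<open>The estimate for a sum with \<open>\<delta> = 1\<close>, with suprema in place
      of the values at \<open>r\<close>; being independent of \<open>r\<close>, it bounds the
      supremum.\<close>
    let ?C = "ennreal (1 + 1) * (ennreal ((cmod a)\<^sup>2) * hardy_sup m \<theta> \<ll> f)
        + ennreal (1 + 1 / 1) * (ennreal ((cmod b)\<^sup>2) * hardy_sup m \<theta> \<ll> g)"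
    have "sqnorm m (\<lambda>\<zeta>. F ?h (r *\<^sub>R \<zeta>)) \<le> ?C" if r: "r \<in> {0<..<1}" for r
    proof -
      have [measurable]: "(\<lambda>\<zeta>. F f (r *\<^sub>R \<zeta>)) \<in> borel_measurable m" "(\<lambda>\<zeta>. F g (r *\<^sub>R \<zeta>)) \<in> borel_measurable m"
        using r by (auto intro!: dilate_borel_measurable holomorphic_vec_imp_continuous_on F_hol H2(1) f g)
      have "F ?h z = a * F f z + b * F g z" for z by (simp add: F_def algebra_simps)
      then have "sqnorm m (\<lambda>\<zeta>. F ?h (r *\<^sub>R \<zeta>)) = sqnorm m (\<lambda>\<zeta>. a * F f (r *\<^sub>R \<zeta>) + b * F g (r *\<^sub>R \<zeta>))"
        by simp
      also have "\<dots> \<le> ennreal (1 + 1) * sqnorm m (\<lambda>\<zeta>. a * F f (r *\<^sub>R \<zeta>)) + ennreal (1 + 1 / 1) * sqnorm m (\<lambda>\<zeta>. b * F g (r *\<^sub>R \<zeta>))"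
        by (intro sqnorm_add_le) auto
      also have "\<dots> = ennreal (1 + 1) * (ennreal ((cmod a)\<^sup>2) * sqnorm m (\<lambda>\<zeta>. F f (r *\<^sub>R \<zeta>)))
          + ennreal (1 + 1 / 1) * (ennreal ((cmod b)\<^sup>2) * sqnorm m (\<lambda>\<zeta>. F g (r *\<^sub>R \<zeta>)))"
        by (subst (1 2) sqnorm_cmult) auto
      also have "\<dots> \<le> ?C"
        unfolding hardy_sup by (intro add_mono mult_left_mono SUP_upper r) auto
      finally show ?thesis .
    qed
    then have "hardy_sup m \<theta> \<ll> ?h \<le> ?C" unfolding hardy_sup[of ?h] by (rule SUP_least)
    also have "?C < \<infinity>"
      using f g by (simp add: H2_space_def ennreal_mult_less_top del: ennreal_plus)
    finally have "hardy_sup m \<theta> \<ll> ?h < \<infinity>" .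
    moreover have "holomorphic_vec ?h (\<theta> ` \<Omega>)"
      by (intro holomorphic_vec_add holomorphic_vec_mult holomorphic_vec_const H2(1) f g)
    ultimately show ?thesis by (simp add: H2_space_def)
  qed
  have linear: "AE w in M. T (\<lambda>w. a * f w + b * g w) w = a * T f w + b * T g w"
    if f: "f \<in> H2_space \<Omega> m \<theta> \<ll>" and g: "g \<in> H2_space \<Omega> m \<theta> \<ll>" for f g a b
  proof (rule sqnorm_limit_lincomb[OF _ u_meas'[OF H2(1)[OF f]] u_meas'[OF H2(1)[OF g]]
        T(1)[OF f] T(1)[OF g] T(1)[OF lincomb[OF f g]] T(2)[OF f] T(2)[OF g]])
    have "u (\<lambda>w. a * f w + b * g w) r w = a * u f r w + b * u g r w" for r w
      by (simp add: u_def algebra_simps)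
    then show "((\<lambda>r. sqnorm M (\<lambda>w. a * u f r w + b * u g r w - T (\<lambda>w. a * f w + b * g w) w)) \<longlongrightarrow> 0) (at_left 1)"
      using T(2)[OF lincomb[OF f g, of a b]] by simp
  qed simp
  show ?thesis
    by (intro exI[of _ T] conjI ballI allI L2 boundary lincomb linear)
qed

theorem lemma2p15:
  fixes \<Omega> :: "(complex^'n) set" and m :: "(complex^'n) measure"
    and G :: "(complex^'n^'n) set" and \<theta> :: "complex^'n \<Rightarrow> complex^'n"
    and \<rho> :: "complex^'n^'n \<Rightarrow> complex" and \<ll> :: "complex^'n \<Rightarrow> complex"
  assumes "(\<Omega> = polydisc \<and> m = torus_measure) \<or> (\<Omega> = ball 0 1 \<and> m = sphere_measure)"
    and "finite G" and "pseudoreflection_group G"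
    and "\<forall>\<sigma>\<in>G. (\<lambda>z. \<sigma> *v z) ` \<Omega> = \<Omega>"
    and "basic_polynomial_map G \<theta>"
    and "one_dim_representation G \<rho>"
    and "generating_polynomial G \<rho> \<ll>"
  defines "M \<equiv> weighted_boundary_measure \<Omega> m \<theta> \<ll>"
  shows "\<exists>T :: (complex^'n \<Rightarrow> complex) \<Rightarrow> (complex^'n \<Rightarrow> complex).
     (\<forall>f\<in>H2_space \<Omega> m \<theta> \<ll>. T f \<in> L2_space M) \<and>
     (\<forall>f\<in>H2_space \<Omega> m \<theta> \<ll>. \<forall>g\<in>H2_space \<Omega> m \<theta> \<ll>. \<forall>a b :: complex.
        (\<lambda>w. a * f w + b * g w) \<in> H2_space \<Omega> m \<theta> \<ll> \<and>
        (AE w in M. T (\<lambda>w. a * f w + b * g w) w = a * T f w + b * T g w)) \<and>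
     (\<forall>f\<in>H2_space \<Omega> m \<theta> \<ll>. L2_norm G M (T f) = H2_norm G m \<theta> \<ll> f) \<and>
     (\<forall>f\<in>H2_space \<Omega> m \<theta> \<ll>. boundary_value m \<theta> \<ll> f (T f))"
proof -
  obtain S R where "circular_domain m \<Omega> S R"
    using assms(1) circular_domain_ball circular_domain_polydisc by blast
  then interpret circular_domain m \<Omega> S R .
  obtain k where k: "\<And>i. homogeneous_fun (k i) (\<lambda>z. \<theta> z $ i)"
    using assms(5) unfolding basic_polynomial_map_def by metis
  obtain d where d: "\<And>r z. \<ll> (r *\<^sub>R z) = of_real r ^ d * \<ll> z"
    using generating_polynomial_scaleR[OF assms(7)] by blast
  have "\<theta> ` S \<subseteq> shilov_boundary (\<theta> ` \<Omega>)"
    using basic_polynomial_map_in_shilov_boundary[OF assms(2,3,5,4) R_pos \<Omega>_subset] S_subset norm_S by blast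
  then show ?thesis
    unfolding M_def
    by (intro hardy_embedding[OF _ _ homogeneous_fun_scaleR[OF k] d] polynomial_fun_imp_holomorphic_vec
        basic_polynomial_map_polynomial_fun[OF assms(5)] generating_polynomial_holomorphic_vec[OF assms(7)])
qed

end
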